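(* For each prime $p>3$ with $p\equiv 1\bmod 8$ or $p\equiv 3\bmod 8$, there exists a Falconer variety $\mathscr{V}_p$ whose smallest non-trivial member is a loop of order $p$.
   Context: A quasigroup $(Q,\cdot,\backslash,/)$ is a non-empty set $Q$ with three binary operations such that for all $x,y\in Q$: $x\cdot(x\backslash y)=y$, $x\backslash(x\cdot y)=y$, $(y/x)\cdot x=y$, $(y\cdot x)/x=y$. (Equivalently, $(Q,\cdot)$ is such that for all $a,b\in Q$ there exist unique $x,y\in Q$ with $a\cdot x=b$ and $y\cdot a=b$.) A loop is a quasigroup with an element $e$ such that $e\cdot q=q\cdot e=q$ for all $q\in Q$. Quasigroups may be infinite; the order of a quasigroup is the cardinality of its underlying set. Given a set $E$ of quasigroup identities (universally quantified equations between terms in $\cdot,\backslash,/$), the loop variety defined by $E$ is the class of all loops satisfying all identities in $E$. Two quasigroups $(Q,\cdot)$ and $(Q',\circ)$ are isotopic if there are bijections $\alpha,\beta,\gamma:Q\to Q'$ with $\alpha(x)\circ\beta(y)=\gamma(x\cdot y)$ for all $x,y\in Q$. A loop variety is isotopically $L$-closed if it contains every loop that is isotopic to any element of the variety. A variety is anti-associative if the only group (i.e. associative loop) it contains is the trivial group. A member of a variety other than the trivial (one-element) group is called non-trivial, and a variety is non-trivial if it has a non-trivial member. A Falconer variety is a non-trivial, anti-associative, isotopically $L$-closed loop variety. *)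

theory Defs
  imports
    "HOL-Algebra.Congruence"
    "HOL-Computational_Algebra.Primes"
    "HOL-Library.Infinite_Typeclass"
begin

section \<open>Quasigroups and loops\<close>

record 'a quasigroup = "'a partial_object" +
  mult :: "'a \<Rightarrow> 'a \<Rightarrow> 'a"
  ldiv :: "'a \<Rightarrow> 'a \<Rightarrow> 'a"  \<comment> \<open>\<open>ldiv Q x y\<close> is x-under-y, the solution z of x z = y\<close>
  rdiv :: "'a \<Rightarrow> 'a \<Rightarrow> 'a"  \<comment> \<open>\<open>rdiv Q y x\<close> is y-over-x, the solution z of z x = y\<close>

definition is_quasigroup :: "'a quasigroup \<Rightarrow> bool" where
  "is_quasigroup Q \<longleftrightarrow>
     carrier Q \<noteq> {} \<and>
     (\<forall>x\<in>carrier Q. \<forall>y\<in>carrier Q.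
        mult Q x y \<in> carrier Q \<and> ldiv Q x y \<in> carrier Q \<and> rdiv Q x y \<in> carrier Q \<and>
        mult Q x (ldiv Q x y) = y \<and>
        ldiv Q x (mult Q x y) = y \<and>
        mult Q (rdiv Q y x) x = y \<and>
        rdiv Q (mult Q y x) x = y)"

definition is_loop :: "'a quasigroup \<Rightarrow> bool" where
  "is_loop Q \<longleftrightarrow>
     is_quasigroup Q \<and>
     (\<exists>e\<in>carrier Q. \<forall>q\<in>carrier Q. mult Q e q = q \<and> mult Q q e = q)"

definition is_assoc :: "'a quasigroup \<Rightarrow> bool" where
  "is_assoc Q \<longleftrightarrow>
     (\<forall>x\<in>carrier Q. \<forall>y\<in>carrier Q. \<forall>z\<in>carrier Q.
        mult Q (mult Q x y) z = mult Q x (mult Q y z))"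

definition nontrivial :: "'a quasigroup \<Rightarrow> bool" where
  "nontrivial Q \<longleftrightarrow> \<not> is_singleton (carrier Q)"

definition isotopic :: "'a quasigroup \<Rightarrow> 'b quasigroup \<Rightarrow> bool" where
  "isotopic Q Q' \<longleftrightarrow>
     (\<exists>\<alpha> \<beta> \<gamma>. bij_betw \<alpha> (carrier Q) (carrier Q') \<and>
              bij_betw \<beta> (carrier Q) (carrier Q') \<and>
              bij_betw \<gamma> (carrier Q) (carrier Q') \<and>
              (\<forall>x\<in>carrier Q. \<forall>y\<in>carrier Q. mult Q' (\<alpha> x) (\<beta> y) = \<gamma> (mult Q x y)))"


section \<open>Identities and loop varieties\<close>

datatype qterm = Var nat | Mult qterm qterm | LDiv qterm qterm | RDiv qterm qterm

fun term_value :: "'a quasigroup \<Rightarrow> (nat \<Rightarrow> 'a) \<Rightarrow> qterm \<Rightarrow> 'a" where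
  "term_value Q \<rho> (Var i) = \<rho> i"
| "term_value Q \<rho> (Mult s t) = mult Q (term_value Q \<rho> s) (term_value Q \<rho> t)"
| "term_value Q \<rho> (LDiv s t) = ldiv Q (term_value Q \<rho> s) (term_value Q \<rho> t)"
| "term_value Q \<rho> (RDiv s t) = rdiv Q (term_value Q \<rho> s) (term_value Q \<rho> t)"

type_synonym identity = "qterm \<times> qterm"

definition satisfies :: "'a quasigroup \<Rightarrow> identity \<Rightarrow> bool" where
  "satisfies Q st \<longleftrightarrow>
     (\<forall>\<rho>. range \<rho> \<subseteq> carrier Q \<longrightarrow> term_value Q \<rho> (fst st) = term_value Q \<rho> (snd st))"

text \<open>The loop variety defined by a set of identities, cut down to the loops whose carrier is
  a subset of the type \<open>'a\<close>. A single set of identities defines such a class for every \<open>'a\<close>.\<close>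

definition loop_variety :: "identity set \<Rightarrow> 'a quasigroup set" where
  "loop_variety E = {Q. is_loop Q \<and> (\<forall>st\<in>E. satisfies Q st)}"


section \<open>Falconer varieties\<close>

definition isotopically_L_closed :: "'a quasigroup set \<Rightarrow> bool" where
  "isotopically_L_closed V \<longleftrightarrow> (\<forall>Q\<in>V. \<forall>Q'. is_loop Q' \<and> isotopic Q Q' \<longrightarrow> Q' \<in> V)"

definition anti_associative :: "'a quasigroup set \<Rightarrow> bool" where
  "anti_associative V \<longleftrightarrow> (\<forall>Q\<in>V. is_assoc Q \<longrightarrow> \<not> nontrivial Q)"

definition nontrivial_variety :: "'a quasigroup set \<Rightarrow> bool" where
  "nontrivial_variety V \<longleftrightarrow> (\<exists>Q\<in>V. nontrivial Q)"

definition falconer_variety :: "'a quasigroup set \<Rightarrow> bool" where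
  "falconer_variety V \<longleftrightarrow>
     (\<exists>E. V = loop_variety E) \<and>
     nontrivial_variety V \<and> anti_associative V \<and> isotopically_L_closed V"

text \<open>The smallest non-trivial member has finite order \<open>n\<close>. As \<open>card\<close> is 0 on infinite sets,
  infinite members are treated separately.\<close>

definition smallest_nontrivial_order :: "'a quasigroup set \<Rightarrow> nat \<Rightarrow> bool" where
  "smallest_nontrivial_order V n \<longleftrightarrow>
     (\<exists>Q\<in>V. nontrivial Q \<and> finite (carrier Q) \<and> card (carrier Q) = n) \<and>
     (\<forall>Q\<in>V. nontrivial Q \<longrightarrow> infinite (carrier Q) \<or> n \<le> card (carrier Q))"

text \<open>A variety is a class of loops over all types at once, but in HOL an existential quantifier
  over identity sets cannot have a quantifier over types in its scope. The choice of the
  identities is therefore a constant, independent of the type: some set of identities with the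
  required properties among the loops on subsets of \<open>nat\<close>. (Restricting this choice to \<open>nat\<close> loses
  nothing: terms are finitary, so by closing countable subsets, a violation of one of the
  properties in any type gives one on a countable carrier.)
  The Falconer property can then be asserted of \<open>\<V> p :: 'a quasigroup set\<close> for
  every infinite type \<open>'a\<close>. Every type embeds into an infinite one; finite types are excluded
  because they may be too small to carry any non-trivial member.\<close>

definition falconer_identities :: "nat \<Rightarrow> identity set" where
  "falconer_identities n =
     (SOME E. falconer_variety (loop_variety E :: nat quasigroup set) \<and>
              smallest_nontrivial_order (loop_variety E :: nat quasigroup set) n)"

definition falconer_class :: "nat \<Rightarrow> 'a quasigroup set"  (\<open>\<V>\<close>) where
  "\<V> n = loop_variety (falconer_identities n)"

end

theory Submission
  imports Defs "HOL-Combinatorics.Permutations" "HOL-Number_Theory.Cong" "HOL-Library.Countable_Set"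
begin

text \<open>On the integers modulo \<open>p\<close> let \<open>B\<close> be the complement of the set of powers of -2. It contains a nonzero
  element, as \<open>(-2)^((p - 1)/2) = 1\<close> for \<open>p\<close> congruent to 1 or 3 modulo 8. Let \<open>x * y = x - h (y - x)\<close>, where \<open>h\<close> is
  multiplication by -2 on \<open>B\<close> and the identity elsewhere. Any two distinct rows of this Latin square differ
  by a \<open>p\<close>-cycle. Indeed, up to scaling and conjugation the row permutation is
  \<open>t \<mapsto> h\<^sup>-\<^sup>1 (h t + 1) + 1\<close>, and the invariance of \<open>B\<close> under multiplication by -2 forces each of its orbits through
  0 or 1; a parity argument then leaves a single orbit.

  The variety is defined by the identities valid in all loop isotopes of this quasigroup. An identity in
  an isotope is an identity in the original quasigroup with two more variables, which makes the variety
  isotopically closed. The identity \<open>x (x (\<dots> (x z))) = z\<close> with \<open>p\<close> factors \<open>x\<close> shows that nontrivial members have at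
  least \<open>p\<close> elements. The isotopes have no proper nontrivial subloops and are not groups, so by an argument in
  the style of Goursat's lemma some term in one variable vanishes in all of them although its exponent
  sum is prime to \<open>p\<close>; together with exponent \<open>p\<close> this rules out nontrivial groups.

  The identities chosen by \<open>falconer_identities\<close> are not these but arbitrary ones with the same properties
  over \<open>nat\<close>. The properties pass to other types because an identity is violated already in a countable
  subloop.\<close>

section \<open>Isotopes and transfer of identities\<close>

lemma quasigroup_closed:
  assumes "is_quasigroup Q" "x \<in> carrier Q" "y \<in> carrier Q"
  shows "mult Q x y \<in> carrier Q" "ldiv Q x y \<in> carrier Q" "rdiv Q x y \<in> carrier Q"
  using assms unfolding is_quasigroup_def by auto

lemma quasigroup_div:
  assumes "is_quasigroup Q" "x \<in> carrier Q" "y \<in> carrier Q"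
  shows "mult Q x (ldiv Q x y) = y" "ldiv Q x (mult Q x y) = y"
    "mult Q (rdiv Q y x) x = y" "rdiv Q (mult Q y x) x = y"
  using assms unfolding is_quasigroup_def by auto

lemma term_value_closed:
  assumes "is_quasigroup Q" "range \<rho> \<subseteq> carrier Q"
  shows "term_value Q \<rho> t \<in> carrier Q"
  using assms by (induction t) (auto intro: quasigroup_closed)

lemma loop_quasigroup: "is_loop Q \<Longrightarrow> is_quasigroup Q"
  by (simp add: is_loop_def)

section \<open>Isomorphisms and transport of structure\<close>

definition quasigroup_iso :: "('a \<Rightarrow> 'b) \<Rightarrow> 'a quasigroup \<Rightarrow> 'b quasigroup \<Rightarrow> bool" where
  "quasigroup_iso h Q Q' \<longleftrightarrow> bij_betw h (carrier Q) (carrier Q') \<and>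
     (\<forall>x\<in>carrier Q. \<forall>y\<in>carrier Q. h (mult Q x y) = mult Q' (h x) (h y))"

context
  fixes h :: "'a \<Rightarrow> 'b" and Q Q'
  assumes Q: "is_quasigroup Q" and Q': "is_quasigroup Q'" and iso: "quasigroup_iso h Q Q'"
begin

lemma iso_mem: "x \<in> carrier Q \<Longrightarrow> h x \<in> carrier Q'"
  using iso by (auto simp: quasigroup_iso_def bij_betw_def)

lemma iso_mult: "x \<in> carrier Q \<Longrightarrow> y \<in> carrier Q \<Longrightarrow> h (mult Q x y) = mult Q' (h x) (h y)"
  using iso by (auto simp: quasigroup_iso_def)

lemma iso_ldiv:
  assumes "x \<in> carrier Q" "y \<in> carrier Q"
  shows "h (ldiv Q x y) = ldiv Q' (h x) (h y)"
proof -
  have "mult Q' (h x) (h (ldiv Q x y)) = h y"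
    using iso_mult assms Q by (metis quasigroup_closed(2) quasigroup_div(1))
  then show ?thesis
    using quasigroup_div(2)[OF Q' iso_mem iso_mem, of x "ldiv Q x y"] assms quasigroup_closed[OF Q] by metis
qed

lemma iso_rdiv:
  assumes "x \<in> carrier Q" "y \<in> carrier Q"
  shows "h (rdiv Q x y) = rdiv Q' (h x) (h y)"
proof -
  have "mult Q' (h (rdiv Q x y)) (h y) = h x"
    using iso_mult assms Q by (metis quasigroup_closed(3) quasigroup_div(3))
  then show ?thesis
    using quasigroup_div(4)[OF Q' iso_mem iso_mem, of y "rdiv Q x y"] assms quasigroup_closed[OF Q] by metis
qed

lemma iso_term_value:
  assumes "range \<rho> \<subseteq> carrier Q"
  shows "h (term_value Q \<rho> t) = term_value Q' (h \<circ> \<rho>) t"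
  by (induction t) (simp_all add: iso_mult iso_ldiv iso_rdiv term_value_closed[OF Q assms])

lemma iso_satisfies: "satisfies Q st \<longleftrightarrow> satisfies Q' st"
proof
  assume s: "satisfies Q st"
  show "satisfies Q' st" unfolding satisfies_def
  proof (intro allI impI)
    fix \<rho>' :: "nat \<Rightarrow> 'b" assume r: "range \<rho>' \<subseteq> carrier Q'"
    define \<rho> where "\<rho> = inv_into (carrier Q) h \<circ> \<rho>'"
    have h: "bij_betw h (carrier Q) (carrier Q')" using iso by (simp add: quasigroup_iso_def)
    have rho: "range \<rho> \<subseteq> carrier Q"
      using r bij_betw_inv_into[OF h] by (auto simp: \<rho>_def bij_betw_def)
    moreover have "h \<circ> \<rho> = \<rho>'"
      using r bij_betw_inv_into_right[OF h] by (auto simp: \<rho>_def fun_eq_iff)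
    ultimately show "term_value Q' \<rho>' (fst st) = term_value Q' \<rho>' (snd st)"
      using s iso_term_value unfolding satisfies_def by metis
  qed
next
  assume s: "satisfies Q' st"
  show "satisfies Q st" unfolding satisfies_def
  proof (intro allI impI)
    fix \<rho> :: "nat \<Rightarrow> 'a" assume r: "range \<rho> \<subseteq> carrier Q"
    then have "range (h \<circ> \<rho>) \<subseteq> carrier Q'" using iso_mem by auto
    then have "h (term_value Q \<rho> (fst st)) = h (term_value Q \<rho> (snd st))"
      using s iso_term_value[OF r] unfolding satisfies_def by metis
    then show "term_value Q \<rho> (fst st) = term_value Q \<rho> (snd st)"
      using iso term_value_closed[OF Q r] unfolding quasigroup_iso_def bij_betw_def by (metis inj_onD)
  qed
qed

lemma iso_loop:
  assumes "is_loop Q"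
  shows "is_loop Q'"
proof -
  obtain e where e: "e \<in> carrier Q" "\<And>q. q \<in> carrier Q \<Longrightarrow> mult Q e q = q \<and> mult Q q e = q"
    using assms by (auto simp: is_loop_def)
  have "\<exists>x\<in>carrier Q. q = h x" if "q \<in> carrier Q'" for q
    using that iso by (auto simp: quasigroup_iso_def bij_betw_def)
  then have "\<forall>q\<in>carrier Q'. mult Q' (h e) q = q \<and> mult Q' q (h e) = q"
    using iso_mult e by metis
  then show ?thesis using Q' iso_mem[OF e(1)] by (auto simp: is_loop_def)
qed

end

lemma iso_loop_variety:
  assumes "Q \<in> loop_variety E" "is_quasigroup Q'" "quasigroup_iso h Q Q'"
  shows "Q' \<in> loop_variety E"
  using assms iso_loop[OF _ assms(2,3)] iso_satisfies[OF _ assms(2,3)]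
  by (auto simp: loop_variety_def loop_quasigroup)

definition transport :: "('a \<Rightarrow> 'b) \<Rightarrow> 'a quasigroup \<Rightarrow> 'b quasigroup" where
  "transport h Q = (let g = inv_into (carrier Q) h in
     \<lparr>carrier = h ` carrier Q, mult = \<lambda>x y. h (mult Q (g x) (g y)),
      ldiv = \<lambda>x y. h (ldiv Q (g x) (g y)), rdiv = \<lambda>x y. h (rdiv Q (g x) (g y))\<rparr>)"

lemma carrier_transport: "carrier (transport h Q) = h ` carrier Q"
  by (simp add: transport_def Let_def)

lemma transport_quasigroup:
  assumes "is_quasigroup Q" "inj_on h (carrier Q)"
  shows "is_quasigroup (transport h Q)" "quasigroup_iso h Q (transport h Q)"
  using assms quasigroup_closed[OF assms(1)] quasigroup_div[OF assms(1)]
  unfolding transport_def Let_def quasigroup_iso_def is_quasigroup_def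
  by (auto simp: bij_betw_def)

section \<open>Principal isotopes and the identities valid in them\<close>

definition principal_isotope :: "'a quasigroup \<Rightarrow> 'a \<Rightarrow> 'a \<Rightarrow> 'a quasigroup" where
  "principal_isotope Q a b =
     \<lparr>carrier = carrier Q,
      mult = \<lambda>u v. mult Q (rdiv Q u b) (ldiv Q a v),
      ldiv = \<lambda>u w. mult Q a (ldiv Q (rdiv Q u b) w),
      rdiv = \<lambda>w v. mult Q (rdiv Q w (ldiv Q a v)) b\<rparr>"

lemma carrier_principal_isotope [simp]: "carrier (principal_isotope Q a b) = carrier Q"
  by (simp add: principal_isotope_def)

context
  fixes Q :: "'a quasigroup" and a b
  assumes Q: "is_quasigroup Q" and ab: "a \<in> carrier Q" "b \<in> carrier Q"
begin

lemma principal_isotope_quasigroup: "is_quasigroup (principal_isotope Q a b)"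
  using Q ab quasigroup_closed[OF Q] quasigroup_div[OF Q]
  unfolding principal_isotope_def is_quasigroup_def by auto

lemma principal_isotope_one:
  assumes "q \<in> carrier Q"
  shows "mult (principal_isotope Q a b) (mult Q a b) q = q" "mult (principal_isotope Q a b) q (mult Q a b) = q"
  using ab quasigroup_closed[OF Q] quasigroup_div[OF Q] assms by (auto simp: principal_isotope_def)

lemma principal_isotope_loop: "is_loop (principal_isotope Q a b)"
  using principal_isotope_quasigroup principal_isotope_one quasigroup_closed[OF Q ab]
  by (auto simp: is_loop_def)

lemma isotopic_principal_isotope: "isotopic Q (principal_isotope Q a b)"
proof -
  have "bij_betw (\<lambda>x. mult Q x b) (carrier Q) (carrier Q)"
    by (rule bij_betwI[of _ _ _ "\<lambda>x. rdiv Q x b"]) (use ab quasigroup_closed[OF Q] quasigroup_div[OF Q] in auto)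
  moreover have "bij_betw (\<lambda>x. mult Q a x) (carrier Q) (carrier Q)"
    by (rule bij_betwI[of _ _ _ "\<lambda>x. ldiv Q a x"]) (use ab quasigroup_closed[OF Q] quasigroup_div[OF Q] in auto)
  moreover have "mult (principal_isotope Q a b) (mult Q x b) (mult Q a y) = mult Q x y"
    if "x \<in> carrier Q" "y \<in> carrier Q" for x y
    using that ab quasigroup_div[OF Q] by (simp add: principal_isotope_def)
  ultimately show ?thesis
    unfolding isotopic_def
    by (intro exI[of _ "\<lambda>x. mult Q x b"] exI[of _ "\<lambda>y. mult Q a y"] exI[of _ id]) simp
qed

end

lemma isotopic_trans:
  assumes "isotopic P Q" "isotopic Q R"
  shows "isotopic P R"
proof -
  obtain a b c where
    1: "bij_betw a (carrier P) (carrier Q)" "bij_betw b (carrier P) (carrier Q)" "bij_betw c (carrier P) (carrier Q)"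
      "\<And>x y. x \<in> carrier P \<Longrightarrow> y \<in> carrier P \<Longrightarrow> mult Q (a x) (b y) = c (mult P x y)"
    using assms(1) unfolding isotopic_def by blast
  obtain a' b' c' where
    2: "bij_betw a' (carrier Q) (carrier R)" "bij_betw b' (carrier Q) (carrier R)" "bij_betw c' (carrier Q) (carrier R)"
      "\<And>x y. x \<in> carrier Q \<Longrightarrow> y \<in> carrier Q \<Longrightarrow> mult R (a' x) (b' y) = c' (mult Q x y)"
    using assms(2) unfolding isotopic_def by blast
  have "mult R ((a' \<circ> a) x) ((b' \<circ> b) y) = (c' \<circ> c) (mult P x y)" if "x \<in> carrier P" "y \<in> carrier P" for x y
    using that 1(4) 2(4)[of "a x" "b y"] bij_betwE[OF 1(1)] bij_betwE[OF 1(2)] by simp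
  then show ?thesis
    unfolding isotopic_def
    using bij_betw_trans[OF 1(1) 2(1)] bij_betw_trans[OF 1(2) 2(2)] bij_betw_trans[OF 1(3) 2(3)]
    by (intro exI[of _ "a' \<circ> a"] exI[of _ "b' \<circ> b"] exI[of _ "c' \<circ> c"]) simp
qed

text \<open>Let \<open>a\<close> and \<open>b\<close> be the preimages of the neutral element of
  \<open>Q'\<close> under \<alpha> and \<beta>. Multiplying by the neutral element shows that
  \<alpha> after division by \<open>b\<close> and \<beta> after division by \<open>a\<close> both
  equal \<gamma>, so \<gamma> is the isomorphism.\<close>

lemma isotopic_loop_principal:
  assumes Q: "is_quasigroup Q" and L: "is_loop Q'" and "isotopic Q Q'"
  shows "\<exists>a\<in>carrier Q. \<exists>b\<in>carrier Q. \<exists>h. quasigroup_iso h (principal_isotope Q a b) Q'"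
proof -
  obtain \<alpha> \<beta> \<gamma> where i: "bij_betw \<alpha> (carrier Q) (carrier Q')" "bij_betw \<beta> (carrier Q) (carrier Q')"
    "bij_betw \<gamma> (carrier Q) (carrier Q')"
    and m: "\<And>x y. x \<in> carrier Q \<Longrightarrow> y \<in> carrier Q \<Longrightarrow> mult Q' (\<alpha> x) (\<beta> y) = \<gamma> (mult Q x y)"
    using assms(3) unfolding isotopic_def by blast
  obtain e where e: "e \<in> carrier Q'" "\<And>q. q \<in> carrier Q' \<Longrightarrow> mult Q' e q = q \<and> mult Q' q e = q"
    using L by (auto simp: is_loop_def)
  obtain a where a: "a \<in> carrier Q" "\<alpha> a = e" using i(1) e(1) by (metis bij_betw_def imageE)
  obtain b where b: "b \<in> carrier Q" "\<beta> b = e" using i(2) e(1) by (metis bij_betw_def imageE)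
  have al: "\<alpha> (rdiv Q u b) = \<gamma> u" if "u \<in> carrier Q" for u
    using m[of "rdiv Q u b" b] that b quasigroup_closed[OF Q] quasigroup_div[OF Q] e(2) i(1)
    by (metis bij_betwE)
  have be: "\<beta> (ldiv Q a v) = \<gamma> v" if "v \<in> carrier Q" for v
    using m[of a "ldiv Q a v"] that a quasigroup_closed[OF Q] quasigroup_div[OF Q] e(2) i(2)
    by (metis bij_betwE)
  have "\<gamma> (mult Q (rdiv Q u b) (ldiv Q a v)) = mult Q' (\<gamma> u) (\<gamma> v)" if "u \<in> carrier Q" "v \<in> carrier Q" for u v
    using m[of "rdiv Q u b" "ldiv Q a v"] al be that a b quasigroup_closed[OF Q] by metis
  then have "quasigroup_iso \<gamma> (principal_isotope Q a b) Q'"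
    using i(3) by (simp add: quasigroup_iso_def principal_isotope_def)
  then show ?thesis using a b by blast
qed

text \<open>The operations of a principal isotope are terms in those of the original quasigroup and
  the parameters \<open>a\<close> and \<open>b\<close>. Variables 0 and 1 are reserved for these
  parameters, hence the shift by 2.\<close>

fun isotope_term :: "qterm \<Rightarrow> qterm" where
  "isotope_term (Var i) = Var (i + 2)"
| "isotope_term (Mult s t) = Mult (RDiv (isotope_term s) (Var 1)) (LDiv (Var 0) (isotope_term t))"
| "isotope_term (LDiv s t) = Mult (Var 0) (LDiv (RDiv (isotope_term s) (Var 1)) (isotope_term t))"
| "isotope_term (RDiv s t) = Mult (RDiv (isotope_term s) (LDiv (Var 0) (isotope_term t))) (Var 1)"

abbreviation isotope_identity :: "identity \<Rightarrow> identity" where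
  "isotope_identity st \<equiv> (isotope_term (fst st), isotope_term (snd st))"

lemma term_value_isotope_term:
  "term_value Q \<sigma> (isotope_term t) = term_value (principal_isotope Q (\<sigma> 0) (\<sigma> 1)) (\<lambda>i. \<sigma> (i + 2)) t"
  by (induction t) (simp_all add: principal_isotope_def)

lemma satisfies_isotope_identity:
  "satisfies Q (isotope_identity st) \<longleftrightarrow>
     (\<forall>a\<in>carrier Q. \<forall>b\<in>carrier Q. satisfies (principal_isotope Q a b) st)"
proof
  assume s: "satisfies Q (isotope_identity st)"
  show "\<forall>a\<in>carrier Q. \<forall>b\<in>carrier Q. satisfies (principal_isotope Q a b) st"
  proof (intro ballI)
    fix a b assume ab: "a \<in> carrier Q" "b \<in> carrier Q"
    show "satisfies (principal_isotope Q a b) st" unfolding satisfies_def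
    proof (intro allI impI)
      fix \<rho> :: "nat \<Rightarrow> 'a" assume r: "range \<rho> \<subseteq> carrier (principal_isotope Q a b)"
      define \<sigma> where "\<sigma> i = (if i = 0 then a else if i = 1 then b else \<rho> (i - 2))" for i
      have "range \<sigma> \<subseteq> carrier Q" using r ab by (auto simp: \<sigma>_def)
      moreover have "(\<lambda>i. \<sigma> (i + 2)) = \<rho>" "\<sigma> 0 = a" "\<sigma> 1 = b" by (auto simp: \<sigma>_def)
      ultimately show "term_value (principal_isotope Q a b) \<rho> (fst st) = term_value (principal_isotope Q a b) \<rho> (snd st)"
        using s term_value_isotope_term[of Q \<sigma>] unfolding satisfies_def fst_conv snd_conv by metis
    qed
  qed
next
  assume s: "\<forall>a\<in>carrier Q. \<forall>b\<in>carrier Q. satisfies (principal_isotope Q a b) st"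
  show "satisfies Q (isotope_identity st)" unfolding satisfies_def fst_conv snd_conv term_value_isotope_term
    using s by (auto simp: satisfies_def image_subset_iff)
qed

text \<open>Closure under isotopy becomes a consequence relation between identities, the form that
  \<open>satisfies_if_satisfies_nat\<close> can transfer to other types.\<close>

lemma isotopically_L_closed_iff:
  "isotopically_L_closed (loop_variety E :: 'a quasigroup set) \<longleftrightarrow>
     (\<forall>Q\<in>(loop_variety E :: 'a quasigroup set). \<forall>st\<in>E. satisfies Q (isotope_identity st))"
proof
  assume c: "isotopically_L_closed (loop_variety E :: 'a quasigroup set)"
  show "\<forall>Q\<in>(loop_variety E :: 'a quasigroup set). \<forall>st\<in>E. satisfies Q (isotope_identity st)"
    unfolding satisfies_isotope_identity
  proof (intro ballI)
    fix Q :: "'a quasigroup" and st a b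
    assume Q: "Q \<in> loop_variety E" "st \<in> E" "a \<in> carrier Q" "b \<in> carrier Q"
    then have "is_quasigroup Q" by (simp add: loop_variety_def loop_quasigroup)
    then have "principal_isotope Q a b \<in> loop_variety E"
      using c[unfolded isotopically_L_closed_def, rule_format, OF Q(1)]
        principal_isotope_loop[OF _ Q(3,4)] isotopic_principal_isotope[OF _ Q(3,4)] by simp
    then show "satisfies (principal_isotope Q a b) st" using Q by (simp add: loop_variety_def)
  qed
next
  assume c: "\<forall>Q\<in>(loop_variety E :: 'a quasigroup set). \<forall>st\<in>E. satisfies Q (isotope_identity st)"
  show "isotopically_L_closed (loop_variety E :: 'a quasigroup set)"
    unfolding isotopically_L_closed_def
  proof (intro ballI allI impI, elim conjE)
    fix Q Q' :: "'a quasigroup"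
    assume Q: "Q \<in> loop_variety E" and Q': "is_loop Q'" and i: "isotopic Q Q'"
    then have q: "is_quasigroup Q" by (simp add: loop_variety_def loop_quasigroup)
    obtain a b h where ab: "a \<in> carrier Q" "b \<in> carrier Q" "quasigroup_iso h (principal_isotope Q a b) Q'"
      using isotopic_loop_principal[OF q Q' i] by blast
    have "principal_isotope Q a b \<in> loop_variety E"
      using c Q ab principal_isotope_loop[OF q] unfolding satisfies_isotope_identity
      by (auto simp: loop_variety_def)
    then show "Q' \<in> loop_variety E"
      using iso_loop_variety[OF _ loop_quasigroup[OF Q'] ab(3)] by simp
  qed
qed

definition assoc_identity :: identity where
  "assoc_identity = (Mult (Mult (Var 0) (Var 1)) (Var 2), Mult (Var 0) (Mult (Var 1) (Var 2)))"

lemma satisfies_assoc: "satisfies Q assoc_identity \<longleftrightarrow> is_assoc Q"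
proof
  assume s: "satisfies Q assoc_identity"
  show "is_assoc Q" unfolding is_assoc_def
  proof (intro ballI)
    fix x y z assume xyz: "x \<in> carrier Q" "y \<in> carrier Q" "z \<in> carrier Q"
    define \<rho> where "\<rho> i = (if i = 0 then x else if i = 1 then y else z)" for i :: nat
    have "range \<rho> \<subseteq> carrier Q" using xyz by (auto simp: \<rho>_def)
    from s[unfolded satisfies_def, rule_format, OF this]
    show "mult Q (mult Q x y) z = mult Q x (mult Q y z)" by (simp add: assoc_identity_def \<rho>_def)
  qed
qed (auto simp: satisfies_def assoc_identity_def is_assoc_def image_subset_iff)

lemma satisfies_trivial:
  assumes "carrier Q \<noteq> {}"
  shows "satisfies Q (Var 0, Var 1) \<longleftrightarrow> \<not> nontrivial Q"
proof
  assume s: "satisfies Q (Var 0, Var 1)"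
  have "x = y" if "x \<in> carrier Q" "y \<in> carrier Q" for x y
  proof -
    define \<rho> where "\<rho> i = (if i = 0 then x else y)" for i :: nat
    have "range \<rho> \<subseteq> carrier Q" using that by (auto simp: \<rho>_def)
    from s[unfolded satisfies_def, rule_format, OF this] show "x = y" by (simp add: \<rho>_def)
  qed
  then show "\<not> nontrivial Q" using assms unfolding nontrivial_def is_singleton_def by blast
next
  assume "\<not> nontrivial Q"
  then obtain x where "carrier Q = {x}" by (auto simp: nontrivial_def is_singleton_def)
  then show "satisfies Q (Var 0, Var 1)" by (simp add: satisfies_def image_subset_iff)
qed

lemma loop_nonempty: "is_loop Q \<Longrightarrow> carrier Q \<noteq> {}"
  by (auto simp: is_loop_def)

lemma anti_associative_iff:
  "anti_associative (loop_variety E :: 'a quasigroup set) \<longleftrightarrow>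
     (\<forall>Q\<in>(loop_variety (insert assoc_identity E) :: 'a quasigroup set). satisfies Q (Var 0, Var 1))"
proof -
  have "Q \<in> loop_variety (insert assoc_identity E) \<longleftrightarrow> Q \<in> loop_variety E \<and> is_assoc Q" for Q :: "'a quasigroup"
    by (auto simp: loop_variety_def satisfies_assoc)
  moreover have "satisfies Q (Var 0, Var 1) \<longleftrightarrow> \<not> nontrivial Q" if "Q \<in> loop_variety E" for Q :: "'a quasigroup"
    by (rule satisfies_trivial[OF loop_nonempty]) (use that in \<open>simp add: loop_variety_def\<close>)
  ultimately show ?thesis unfolding anti_associative_def by blast
qed

section \<open>Transfer of varieties between carrier types\<close>

instance qterm :: countable
  by countable_datatype

lemma term_value_carrier_update: "term_value (Q\<lparr>carrier := S\<rparr>) \<rho> t = term_value Q \<rho> t"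
  by (induction t) simp_all

text \<open>A violation under the assignment \<rho> already occurs in the subloop generated by the
  values of \<rho>. It is countable because there are countably many terms, so it has a copy on a
  subset of \<open>nat\<close>.\<close>

lemma satisfies_if_satisfies_nat:
  assumes "\<forall>Q\<in>(loop_variety E :: nat quasigroup set). satisfies Q st"
    and "(Q :: 'a quasigroup) \<in> loop_variety E"
  shows "satisfies Q st"
  unfolding satisfies_def
proof (intro allI impI)
  fix \<rho> :: "nat \<Rightarrow> 'a" assume r: "range \<rho> \<subseteq> carrier Q"
  have L: "is_loop Q" using assms(2) by (simp add: loop_variety_def)
  then have q: "is_quasigroup Q" by (rule loop_quasigroup)
  define S where "S = range (term_value Q \<rho>)"
  define P where "P = Q\<lparr>carrier := S\<rparr>"
  have SQ: "S \<subseteq> carrier Q" using term_value_closed[OF q r] by (auto simp: S_def)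
  have rS: "range \<rho> \<subseteq> S" unfolding S_def by (auto intro: range_eqI[of _ _ "Var i" for i])
  have cl: "mult Q x y \<in> S" "ldiv Q x y \<in> S" "rdiv Q x y \<in> S" if xy: "x \<in> S" "y \<in> S" for x y
  proof -
    obtain s t where "x = term_value Q \<rho> s" "y = term_value Q \<rho> t" using xy by (auto simp: S_def)
    then have "mult Q x y = term_value Q \<rho> (Mult s t)" "ldiv Q x y = term_value Q \<rho> (LDiv s t)"
      "rdiv Q x y = term_value Q \<rho> (RDiv s t)" by simp_all
    then show "mult Q x y \<in> S" "ldiv Q x y \<in> S" "rdiv Q x y \<in> S" unfolding S_def by (metis rangeI)+
  qed
  have qP: "is_quasigroup P"
    using q SQ cl rS unfolding is_quasigroup_def P_def by (auto simp: subset_iff)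
  obtain e where e: "e \<in> carrier Q" "\<And>q. q \<in> carrier Q \<Longrightarrow> mult Q e q = q \<and> mult Q q e = q"
    using L by (auto simp: is_loop_def)
  have "\<rho> 0 \<in> S" using rS by auto
  \<comment> \<open>The neutral element is x / x for any element x, so a subset closed under
    division contains it.\<close>
  then have "e \<in> S" using cl(3)[of "\<rho> 0" "\<rho> 0"] quasigroup_div(4)[OF q _ e(1), of "\<rho> 0"] e SQ by (metis subsetD)
  then have "is_loop P" using qP e SQ by (auto simp: is_loop_def P_def)
  moreover have "satisfies P uv" if "satisfies Q uv" for uv
    using that SQ unfolding satisfies_def P_def term_value_carrier_update by auto
  ultimately have P: "P \<in> loop_variety E" using assms(2) by (simp add: loop_variety_def)
  have "countable S" unfolding S_def by simp
  then have inj: "inj_on (to_nat_on S) (carrier P)" by (simp add: P_def inj_on_to_nat_on)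
  have "transport (to_nat_on S) P \<in> loop_variety E"
    by (rule iso_loop_variety[OF P transport_quasigroup[OF qP inj]])
  then have "satisfies P st"
    using assms(1) iso_satisfies[OF qP transport_quasigroup[OF qP inj]] by blast
  then show "term_value Q \<rho> (fst st) = term_value Q \<rho> (snd st)"
    using rS by (simp add: satisfies_def P_def term_value_carrier_update)
qed

lemma nontrivial_card: "finite (carrier Q) \<Longrightarrow> nontrivial Q \<longleftrightarrow> card (carrier Q) \<noteq> 1"
  by (simp add: nontrivial_def is_singleton_altdef)

lemma finite_member_transfer:
  fixes Q :: "'a quasigroup"
  assumes "Q \<in> loop_variety E" "finite (carrier Q)" "infinite (UNIV :: 'b set)"
  shows "\<exists>Q'\<in>(loop_variety E :: 'b quasigroup set). finite (carrier Q') \<and> card (carrier Q') = card (carrier Q)"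
proof -
  have q: "is_quasigroup Q" using assms(1) by (simp add: loop_variety_def loop_quasigroup)
  obtain f :: "nat \<Rightarrow> 'b" where f: "inj f" using infinite_countable_subset[OF assms(3)] by blast
  define h where "h = f \<circ> to_nat_on (carrier Q)"
  have inj: "inj_on h (carrier Q)"
    unfolding h_def using assms(2) f by (intro comp_inj_on inj_on_to_nat_on countable_finite) (auto intro: inj_on_subset)
  have "transport h Q \<in> loop_variety E"
    by (rule iso_loop_variety[OF assms(1) transport_quasigroup[OF q inj]])
  then show ?thesis using assms(2) inj by (intro bexI[of _ "transport h Q"]) (auto simp: carrier_transport card_image)
qed

text \<open>Isotopic closure and anti-associativity both say that certain identities hold in all
  loops satisfying given ones, so they pass from \<open>nat\<close> to any type. A nontrivial member
  of too small an order would have a copy on \<open>nat\<close>.\<close>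

theorem falconer_transfer:
  assumes F: "falconer_variety (loop_variety E :: nat quasigroup set)"
    and S: "smallest_nontrivial_order (loop_variety E :: nat quasigroup set) n"
  shows "falconer_variety (loop_variety E :: 'a::infinite quasigroup set)"
    and "smallest_nontrivial_order (loop_variety E :: 'a::infinite quasigroup set) n"
proof -
  have inf: "infinite (UNIV :: 'a set)" by (rule infinite_UNIV)
  obtain Q :: "nat quasigroup" where Q: "Q \<in> loop_variety E" "nontrivial Q" "finite (carrier Q)" "card (carrier Q) = n"
    using S by (auto simp: smallest_nontrivial_order_def)
  obtain Q' :: "'a quasigroup" where Q': "Q' \<in> loop_variety E" "finite (carrier Q')" "card (carrier Q') = n"
    using finite_member_transfer[OF Q(1,3) inf] Q(4) by metis
  have nt: "nontrivial Q'" using Q Q' nontrivial_card by metis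
  show sm: "smallest_nontrivial_order (loop_variety E :: 'a quasigroup set) n"
    unfolding smallest_nontrivial_order_def
  proof (intro conjI ballI impI)
    show "\<exists>Q\<in>(loop_variety E :: 'a quasigroup set). nontrivial Q \<and> finite (carrier Q) \<and> card (carrier Q) = n"
      using Q' nt by blast
    fix P :: "'a quasigroup" assume P: "P \<in> loop_variety E" "nontrivial P"
    show "infinite (carrier P) \<or> n \<le> card (carrier P)"
    proof (cases "finite (carrier P)")
      case True
      then obtain P' :: "nat quasigroup" where P': "P' \<in> loop_variety E" "finite (carrier P')"
        "card (carrier P') = card (carrier P)"
        using finite_member_transfer[OF P(1) True infinite_UNIV_nat] by metis
      then have "nontrivial P'" using nontrivial_card P True by metis
      then show ?thesis using S P' unfolding smallest_nontrivial_order_def by metis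
    qed simp
  qed
  have "anti_associative (loop_variety E :: 'a quasigroup set)"
    unfolding anti_associative_iff
    using F satisfies_if_satisfies_nat[of "insert assoc_identity E"]
    unfolding falconer_variety_def anti_associative_iff by blast
  moreover have "isotopically_L_closed (loop_variety E :: 'a quasigroup set)"
    unfolding isotopically_L_closed_iff
    using F satisfies_if_satisfies_nat[of E]
    unfolding falconer_variety_def isotopically_L_closed_iff by blast
  ultimately show "falconer_variety (loop_variety E :: 'a quasigroup set)"
    using Q' nt unfolding falconer_variety_def nontrivial_variety_def by blast
qed

section \<open>A walk between two copies of the integers modulo \<open>n\<close>\<close>

lemma even_neg:
  assumes "even (y :: int)"
  shows "\<exists>x. y = -2 * x"
  using assms by (intro exI[of _ "-(y div 2)"]) simp

text \<open>\<open>B\<close> is a union of residue classes of integers rather than a set of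
  residues, since the order and size of integers matter below. The locale is also used for the
  negative of \<open>B\<close> and for \<open>B\<close> divided by a residue.\<close>

locale band_walk =
  fixes n :: int and B :: "int set"
  assumes odd_n: "odd n" and n_pos: "n > 0"
    and B_mod: "x mod n \<in> B \<longleftrightarrow> x \<in> B"
    and B_dbl: "-2 * x \<in> B \<longleftrightarrow> x \<in> B"
    and B_0: "0 \<in> B"
begin

definition half :: int where "half = (n - 1) div 2"

definition Lam :: "int \<Rightarrow> bool \<times> int" where "Lam x = (False, x mod n)"
definition Rho :: "int \<Rightarrow> bool \<times> int" where "Rho x = (True, x mod n)"

fun step :: "bool \<times> int \<Rightarrow> bool \<times> int" where
  "step (False, x) = (True, ((if x \<in> B then -2 * x else x) + 1) mod n)"
| "step (True, x) = (False, ((if x \<in> B then half * x else x) + 1) mod n)"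

text \<open>A step crosses to the other copy, the coordinate being multiplied by -2 or its inverse \<open>half\<close>
  when the crossing point lies in \<open>B\<close>, and then adds 1. Measured in one fixed coordinate, the step
  length has changed by a power of -2; the weight records the change of the exponent.\<close>

fun weight :: "bool \<times> int \<Rightarrow> int" where
  "weight (False, x) = (if x \<in> B then -1 else 0)"
| "weight (True, x) = (if x \<in> B then 1 else 0)"

definition path :: "nat \<Rightarrow> bool \<times> int \<Rightarrow> int \<Rightarrow> bool \<times> int \<Rightarrow> bool" where
  "path k s e s' \<longleftrightarrow> (step ^^ k) s = s' \<and> (\<Sum>j<k. weight ((step ^^ j) s)) = e"

lemma B_cong: "x mod n = y mod n \<Longrightarrow> x \<in> B \<longleftrightarrow> y \<in> B"
  using B_mod[of x] B_mod[of y] by simp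

lemma two_half: "2 * half = n - 1"
  using odd_n by (auto simp: half_def elim!: oddE)

lemma half_dbl: "(half * (-2 * x)) mod n = x mod n"
proof -
  have "half * (-2 * x) = - (2 * half) * x" by simp
  also have "\<dots> = x + (- x) * n" unfolding two_half by (simp add: algebra_simps)
  finally have "half * (-2 * x) = x + (- x) * n" .
  then show ?thesis by (metis mod_mult_self1)
qed

lemma dbl_half: "(-2 * (half * x)) mod n = x mod n"
  using half_dbl[of x] by (simp add: mult.left_commute)

lemma half_B: "half * x \<in> B \<longleftrightarrow> x \<in> B"
  using B_dbl[of "half * x"] B_cong[OF dbl_half[of x]] by simp

lemma step_Lam: "step (Lam x) = (if x \<in> B then Rho (-2 * x + 1) else Rho (x + 1))"
proof -
  have "(-2 * (x mod n) + 1) mod n = (-2 * x + 1) mod n" for x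
    by (metis mod_add_cong mod_mult_right_eq)
  then show ?thesis by (simp add: Lam_def Rho_def B_mod mod_simps)
qed

lemma step_Rho: "step (Rho x) = (if x \<in> B then Lam (half * x + 1) else Lam (x + 1))"
proof -
  have "(half * (x mod n) + 1) mod n = (half * x + 1) mod n" for x
    by (metis mod_add_cong mod_mult_right_eq)
  then show ?thesis by (simp add: Lam_def Rho_def B_mod mod_simps)
qed

lemma weight_Lam: "weight (Lam x) = (if x \<in> B then -1 else 0)"
  and weight_Rho: "weight (Rho x) = (if x \<in> B then 1 else 0)"
  by (simp_all add: Lam_def Rho_def B_mod)

lemma Lam_cong: "x mod n = y mod n \<Longrightarrow> Lam x = Lam y"
  and Rho_cong: "x mod n = y mod n \<Longrightarrow> Rho x = Rho y"
  by (simp_all add: Lam_def Rho_def)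

lemma path_0: "path 0 s 0 s"
  by (simp add: path_def)

lemma path_1: "path 1 s (weight s) (step s)"
  by (simp add: path_def)

lemma path_trans:
  assumes "path k s e s'" "path l s' f s''"
  shows "path (k + l) s (e + f) s''"
proof -
  have 1: "(step ^^ (k + j)) s = (step ^^ j) s'" for j
    using assms(1) by (simp add: path_def funpow_add[of j k] add.commute[of k])
  have "(\<Sum>j<k + l. weight ((step ^^ j) s)) =
        (\<Sum>j<k. weight ((step ^^ j) s)) + (\<Sum>j<l. weight ((step ^^ (k + j)) s))" for l
    by (induction l) auto
  then show ?thesis using assms 1 by (simp add: path_def)
qed

text \<open>Off \<open>B\<close> both kinds of step just change the copy and add 1, without
  weight.\<close>

lemma run:
  assumes "\<And>j. 0 \<le> j \<Longrightarrow> j < 2 * int m \<Longrightarrow> x + j \<notin> B"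
  shows "path (2 * m) (Lam x) 0 (Lam (x + 2 * int m)) \<and> path (2 * m) (Rho x) 0 (Rho (x + 2 * int m))"
  using assms
proof (induction m)
  case 0
  then show ?case by (simp add: path_0)
next
  case (Suc m)
  have a: "x + 2 * int m \<notin> B" "x + (2 * int m + 1) \<notin> B" using Suc.prems by auto
  have IH: "path (2 * m) (Lam x) 0 (Lam (x + 2 * int m))" "path (2 * m) (Rho x) 0 (Rho (x + 2 * int m))"
    using Suc.IH Suc.prems by auto
  have "path 1 (Lam (x + 2 * int m)) 0 (Rho (x + 2 * int m + 1))"
       "path 1 (Rho (x + 2 * int m)) 0 (Lam (x + 2 * int m + 1))"
       "path 1 (Lam (x + 2 * int m + 1)) 0 (Rho (x + 2 * int m + 2))"
       "path 1 (Rho (x + 2 * int m + 1)) 0 (Lam (x + 2 * int m + 2))"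
    using a path_1[of "Lam (x + 2 * int m)"] path_1[of "Rho (x + 2 * int m)"]
      path_1[of "Lam (x + 2 * int m + 1)"] path_1[of "Rho (x + 2 * int m + 1)"]
    by (simp_all add: step_Lam step_Rho weight_Lam weight_Rho add.assoc)
  from path_trans[OF path_trans[OF IH(1) this(1)] this(4)] path_trans[OF path_trans[OF IH(2) this(2)] this(3)]
  show ?case by (simp add: algebra_simps)
qed

lemma run_odd:
  assumes "\<And>j. 0 \<le> j \<Longrightarrow> j < 2 * int m + 1 \<Longrightarrow> x + j \<notin> B"
  shows "path (2 * m + 1) (Lam x) 0 (Rho (x + 2 * int m + 1))"
    and "path (2 * m + 1) (Rho x) 0 (Lam (x + 2 * int m + 1))"
proof -
  have r: "path (2 * m) (Lam x) 0 (Lam (x + 2 * int m))" "path (2 * m) (Rho x) 0 (Rho (x + 2 * int m))"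
    using run[of m x] assms by auto
  have a: "x + 2 * int m \<notin> B" using assms by auto
  have "path 1 (Lam (x + 2 * int m)) 0 (Rho (x + 2 * int m + 1))"
       "path 1 (Rho (x + 2 * int m)) 0 (Lam (x + 2 * int m + 1))"
    using a path_1[of "Lam (x + 2 * int m)"] path_1[of "Rho (x + 2 * int m)"]
    by (simp_all add: step_Lam step_Rho weight_Lam weight_Rho)
  from path_trans[OF r(1) this(1)] path_trans[OF r(2) this(2)]
  show "path (2 * m + 1) (Lam x) 0 (Rho (x + 2 * int m + 1))"
    and "path (2 * m + 1) (Rho x) 0 (Lam (x + 2 * int m + 1))" by simp_all
qed

section \<open>Gaps between consecutive elements of \<open>B\<close> and excursions over
  them\<close>

definition gap :: "int \<Rightarrow> int \<Rightarrow> bool" where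
  "gap b g \<longleftrightarrow> g > 0 \<and> b + g \<in> B \<and> (\<forall>j. 0 < j \<and> j < g \<longrightarrow> b + j \<notin> B)"

lemma ex_gap:
  assumes "\<exists>g>0. b + g \<in> B"
  shows "\<exists>g. gap b g"
proof -
  obtain g where g: "g > 0" "b + g \<in> B" using assms by auto
  define m where "m = (LEAST m. m > 0 \<and> b + int m \<in> B)"
  have "\<exists>m>0. b + int m \<in> B" using g by (intro exI[of _ "nat g"]) auto
  then have m: "m > 0 \<and> b + int m \<in> B" unfolding m_def by (rule LeastI_ex)
  have "b + j \<notin> B" if "0 < j" "j < int m" for j
    using not_less_Least[of "nat j" "\<lambda>m. m > 0 \<and> b + int m \<in> B"] that unfolding m_def[symmetric]
    by auto
  then show ?thesis using m unfolding gap_def by (intro exI[of _ "int m"]) auto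
qed

lemma gap_exists: "\<exists>g. gap b g"
proof (rule ex_gap)
  define g where "g = n - b mod n"
  have "b + g = n * (b div n + 1)"
    unfolding g_def using mult_div_mod_eq[of n b] by (simp add: algebra_simps)
  then have "(b + g) mod n = 0" by simp
  then have "b + g \<in> B" using B_cong[of "b+g" 0] B_0 by simp
  moreover have "g > 0" using n_pos by (simp add: g_def)
  ultimately show "\<exists>g>0. b + g \<in> B" by blast
qed

text \<open>Multiplication by -2 preserves membership in \<open>B\<close> and turns unit steps
  upwards in the left coordinate into steps of 2 downwards in the right one.\<close>

lemma half_shift: "half * x + j \<in> B \<longleftrightarrow> x - 2 * j \<in> B"
proof -
  have "(-2 * (half * x + j)) mod n = (x - 2 * j) mod n"
    using mod_diff_cong[OF dbl_half[of x] refl, of "2 * j"] by (simp only: distrib_left minus_mult_left[symmetric] add_uminus_conv_diff)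
  then show ?thesis using B_cong[of "-2 * (half * x + j)" "x - 2 * j"] B_dbl[of "half * x + j"] by blast
qed

text \<open>If \<open>g\<close> is even, the walk first arrives at \<open>b + g\<close> on the right copy. It then returns to \<open>b\<close> by the
  same kind of excursion with steps of length 2 in the opposite direction, over a gap of half the
  length, and traverses the gap again with the roles of the two copies exchanged.\<close>

lemma excursion:
  assumes "b \<in> B" "gap b g"
  shows "\<exists>k. path k (Lam (b + 1)) 0 (Lam (b + g))"
  using assms
proof (induction "nat g" arbitrary: b g rule: less_induct)
  case less
  have gp: "g > 0" "b + g \<in> B" and gn: "\<And>j. 0 < j \<Longrightarrow> j < g \<Longrightarrow> b + j \<notin> B"
    using less.prems by (auto simp: gap_def)
  show ?case
  proof (cases "odd g")
    case True
    then obtain m where m: "g = 2 * m + 1" by (elim oddE)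
    with gp have "m \<ge> 0" by simp
    have np: "b + 1 + j \<notin> B" if "0 \<le> j" "j < 2 * int (nat m)" for j
      using gn[of "1 + j"] that m \<open>m \<ge> 0\<close> by (simp add: add.assoc)
    have "path (2 * nat m) (Lam (b + 1)) 0 (Lam (b + 1 + 2 * int (nat m)))"
      using run[of "nat m" "b + 1", OF np] by blast
    then show ?thesis using m \<open>m \<ge> 0\<close> by (auto simp: algebra_simps)
  next
    case False
    then obtain m where m: "g = 2 * m" by auto
    with gp have "m > 0" by simp
    define b' where "b' = half * (b + g)"
    have np: "b + 1 + j \<notin> B" if "0 \<le> j" "j < 2 * int (nat (m - 1)) + 1" for j
      using gn[of "1 + j"] that m \<open>m > 0\<close> by (simp add: add.assoc)
    have r: "b + 1 + 2 * int (nat (m - 1)) + 1 = b + g" using m \<open>m > 0\<close> by simp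
    note p1 = run_odd(1)[of "nat (m-1)" "b + 1", OF np, unfolded r]
      and p5 = run_odd(2)[of "nat (m-1)" "b + 1", OF np, unfolded r]
    have p2: "path 1 (Rho (b + g)) 1 (Lam (b' + 1))"
      using path_1[of "Rho (b + g)"] gp by (simp add: step_Rho weight_Rho b'_def)
    have "gap b' m"
      unfolding gap_def
    proof (intro conjI allI impI)
      show "b' + m \<in> B" using less.prems m by (simp add: b'_def half_shift)
      show "b' + j \<notin> B" if "0 < j \<and> j < m" for j
        using gn[of "2 * m - 2 * j"] that m by (simp add: b'_def half_shift add_diff_eq)
    qed (fact \<open>m > 0\<close>)
    moreover have "b' \<in> B" using gp by (simp add: b'_def half_B)
    ultimately obtain k where p3: "path k (Lam (b' + 1)) 0 (Lam (b' + m))"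
      using less.hyps[of m b'] m \<open>m > 0\<close> by auto
    have "(-2 * (b' + m) + 1) mod n = (b + 1) mod n"
      using mod_add_cong[OF dbl_half[of "b + g"], of "1 - g" "1 - g"] m
      by (simp add: b'_def algebra_simps)
    then have "Rho (-2 * (b' + m) + 1) = Rho (b + 1)" by (rule Rho_cong)
    moreover have "b' + m \<in> B" using less.prems m by (simp add: b'_def half_shift)
    ultimately have p4: "path 1 (Lam (b' + m)) (-1) (Rho (b + 1))"
      using path_1[of "Lam (b' + m)"] by (simp add: step_Lam weight_Lam)
    show ?thesis
      using path_trans[OF path_trans[OF path_trans[OF path_trans[OF p1 p2] p3] p4] p5] by auto
  qed
qed


text \<open>\<open>Lam_half z\<close> is the left state whose right coordinate is \<open>z\<close>.\<close>

definition Lam_half :: "int \<Rightarrow> bool \<times> int" where "Lam_half z = Lam (half * z)"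

section \<open>The chain of left states whose right coordinate lies in \<open>B\<close>\<close>

lemma Lam_half_cong: "x mod n = y mod n \<Longrightarrow> Lam_half x = Lam_half y"
  unfolding Lam_half_def by (intro Lam_cong mod_mult_cong refl)

lemma path_Lam_half:
  assumes "z \<in> B"
  shows "path 1 (Lam_half z) (-1) (Rho (z + 1))"
proof -
  have "(-2 * (half * z) + 1) mod n = (z + 1) mod n"
    using mod_add_cong[OF dbl_half[of z] refl] by simp
  then have "Rho (-2 * (half * z) + 1) = Rho (z + 1)" by (rule Rho_cong)
  then show ?thesis
    using path_1[of "Lam_half z"] assms by (simp add: Lam_half_def step_Lam weight_Lam half_B)
qed

text \<open>The crossing at \<open>z\<close> has weight -1. An even gap then brings the walk back to
  the left copy at the next element of \<open>B\<close>. After an odd gap it crosses back at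
  \<open>z + g\<close>, which restores the weight, and an excursion in steps of -2 ends at the
  largest element of \<open>B\<close> below \<open>z\<close> of the opposite parity.\<close>

lemma chain_step:
  assumes z: "z \<in> B" and g: "gap z g"
  shows "(even g \<longrightarrow> (\<exists>k>0. path k (Lam_half z) (-1) (Lam_half (-2 * (z + g))))) \<and>
    (odd g \<longrightarrow> (\<exists>k>0. \<exists>e. path k (Lam_half z) e (Rho (z + g))) \<and>
      (\<exists>k>0. \<exists>z'\<in>B. path k (Lam_half z) 0 (Lam_half z') \<and> z' < z \<and> odd (z - z') \<and>
        (\<forall>y. z' < y \<and> y < z \<and> odd (z - y) \<longrightarrow> y \<notin> B)))"
proof -
  have gp: "g > 0" "z + g \<in> B" and gn: "\<And>j. 0 < j \<Longrightarrow> j < g \<Longrightarrow> z + j \<notin> B"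
    using g by (auto simp: gap_def)
  note p1 = path_Lam_half[OF z]
  show ?thesis
  proof (intro conjI impI)
    assume "even g"
    then obtain m where m: "g = 2 * m" by auto
    with gp have "m > 0" by simp
    have np: "z + 1 + j \<notin> B" if "0 \<le> j" "j < 2 * int (nat (m - 1)) + 1" for j
      using gn[of "1 + j"] that m \<open>m > 0\<close> by (simp add: add.assoc)
    have r: "z + 1 + 2 * int (nat (m - 1)) + 1 = z + g" using m \<open>m > 0\<close> by simp
    have "path (2 * nat (m - 1) + 1) (Rho (z + 1)) 0 (Lam (z + g))"
      using run_odd(2)[of "nat (m-1)" "z + 1", OF np, unfolded r] .
    moreover have "Lam (z + g) = Lam_half (-2 * (z + g))"
      unfolding Lam_half_def by (rule Lam_cong) (simp only: half_dbl)
    ultimately have "path (2 * nat (m - 1) + 1) (Rho (z + 1)) 0 (Lam_half (-2 * (z + g)))"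
      by metis
    from path_trans[OF p1 this] show "\<exists>k>0. path k (Lam_half z) (-1) (Lam_half (-2 * (z + g)))"
      by (intro exI[of _ "1 + (2 * nat (m - 1) + 1)"]) simp
  next
    assume "odd g"
    then obtain m where m: "g = 2 * m + 1" by (elim oddE)
    with gp have "m \<ge> 0" by simp
    have np: "z + 1 + j \<notin> B" if "0 \<le> j" "j < 2 * int (nat m)" for j
      using gn[of "1 + j"] that m \<open>m \<ge> 0\<close> by (simp add: add.assoc)
    have r: "z + 1 + 2 * int (nat m) = z + g" using m \<open>m \<ge> 0\<close> by simp
    have "path (2 * nat m) (Rho (z + 1)) 0 (Rho (z + g))"
      using run[of "nat m" "z + 1", OF np] unfolding r by blast
    note p2 = path_trans[OF p1 this]
    then show "\<exists>k>0. \<exists>e. path k (Lam_half z) e (Rho (z + g))"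
      by (intro exI[of _ "1 + 2 * nat m"] conjI exI) auto
    have p3: "path 1 (Rho (z + g)) 1 (Lam (half * (z + g) + 1))"
      using path_1[of "Rho (z + g)"] gp by (simp add: step_Rho weight_Rho)
    obtain l where l: "gap (half * (z + g)) l" using gap_exists by blast
    have lB: "z + g - 2 * l \<in> B" "l > 0" and ln: "\<And>j. 0 < j \<Longrightarrow> j < l \<Longrightarrow> z + g - 2 * j \<notin> B"
      using l by (auto simp: gap_def half_shift)
    obtain k where p4: "path k (Lam (half * (z + g) + 1)) 0 (Lam (half * (z + g) + l))"
      using excursion[OF _ l] gp by (auto simp: half_B)
    have "(half * (-2 * l)) mod n = l mod n" by (simp only: half_dbl)
    then have "(half * (z + g) + l) mod n = (half * (z + g) + half * (-2 * l)) mod n"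
      by (intro mod_add_cong) simp_all
    also have "half * (z + g) + half * (-2 * l) = half * (z + g - 2 * l)"
      by (simp add: algebra_simps)
    finally have "Lam (half * (z + g) + l) = Lam_half (z + g - 2 * l)"
      unfolding Lam_half_def by (rule Lam_cong)
    note p5 = path_trans[OF path_trans[OF p2 p3] p4, unfolded this]
    \<comment> \<open>The end point cannot lie strictly between \<open>z\<close> and
      \<open>z + g\<close>, where there is no element of \<open>B\<close>, and by parity it is not
      \<open>z\<close>.\<close>
    have down: "z + g - 2 * l < z"
    proof (rule ccontr)
      assume "\<not> ?thesis"
      moreover have "g \<noteq> 2 * l" using \<open>odd g\<close> by auto
      ultimately have "0 < g - 2 * l" "g - 2 * l < g" using lB by auto
      then show False using gn[of "g - 2 * l"] lB by (simp add: add_diff_eq)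
    qed
    have none: "y \<notin> B" if "z + g - 2 * l < y" "y < z" "odd (z - y)" for y
    proof -
      have "even (z + g - y)" using that \<open>odd g\<close> by simp
      then obtain j where j: "z + g - y = 2 * j" by (rule evenE)
      then have "0 < j" "j < l" using that gp by auto
      moreover have "y = z + g - 2 * j" using j by simp
      ultimately show ?thesis using ln[of j] by simp
    qed
    show "\<exists>k>0. \<exists>z'\<in>B. path k (Lam_half z) 0 (Lam_half z') \<and> z' < z \<and> odd (z - z') \<and>
        (\<forall>y. z' < y \<and> y < z \<and> odd (z - y) \<longrightarrow> y \<notin> B)"
    proof (intro exI conjI bexI)
      show "path (1 + 2 * nat m + 1 + k) (Lam_half z) 0 (Lam_half (z + g - 2 * l))" using p5 by simp
      show "z + g - 2 * l \<in> B" "z + g - 2 * l < z" by fact+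
      show "odd (z - (z + g - 2 * l))" using \<open>odd g\<close> by simp
      show "0 < 1 + 2 * nat m + 1 + k" by simp
      show "\<forall>y. z + g - 2 * l < y \<and> y < z \<and> odd (z - y) \<longrightarrow> y \<notin> B" using none by blast
    qed
  qed
qed

text \<open>Every nonzero integer is, up to a power of -2, an odd integer of the same class and at most the
  same size; this is what makes the absence of odd elements of \<open>B\<close> (relative to \<open>Z\<close>) so restrictive.\<close>

lemma crossing:
  assumes Z: "n dvd Z" and z: "z \<in> B" "Z < z" and z': "z' < Z" "z' \<in> B" "odd (z - z')"
    and none: "\<And>y. z' < y \<Longrightarrow> y < z \<Longrightarrow> odd (z - y) \<Longrightarrow> y \<notin> B"
  shows "gap z' (Z - z')"
proof -
  have ZB: "Z + y \<in> B \<longleftrightarrow> y \<in> B" for y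
    using Z by (intro B_cong) (auto elim!: dvdE)
  define t s where "t = z - Z" and "s = Z - z'"
  have pos: "t > 0" "s > 0" using assms by (auto simp: t_def s_def)
  have tB: "t \<in> B" using z ZB[of t] by (simp add: t_def)
  have ev: "even t"
  proof (rule ccontr)
    assume "odd t"
    then have "Z \<notin> B" using none[of Z] z z' by (simp add: t_def)
    then show False using ZB[of 0] B_0 by simp
  qed
  then have os: "odd s" using z' by (auto simp: t_def s_def)
  have oddn: "y \<notin> B" if "odd y" "-s < y" "y < t" for y
  proof -
    have "Z + y \<notin> B" using none[of "Z + y"] that ev by (auto simp: t_def s_def)
    then show ?thesis using ZB by simp
  qed
  \<comment> \<open>Otherwise all nonzero integers of size at most \<open>t / 2\<close> lie outside
    \<open>B\<close>, odd ones by \<open>oddn\<close> and even ones by division by -2. Then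
    \<open>- t / 2\<close>, and with it \<open>t\<close>, would lie outside
    \<open>B\<close>.\<close>
  have st: "2 * s \<le> t"
  proof (rule ccontr)
    assume c: "\<not> ?thesis"
    have "y \<notin> B" if "y \<noteq> 0" "2 * \<bar>y\<bar> \<le> t" for y
      using that
    proof (induction "nat \<bar>y\<bar>" arbitrary: y rule: less_induct)
      case less
      show ?case
      proof (cases "odd y")
        case True then show ?thesis using oddn[of y] less.prems c by auto
      next
        case False
        then obtain x where x: "y = -2 * x" using even_neg by blast
        then have "x \<notin> B" using less.hyps[of x] less.prems by auto
        then show ?thesis using B_dbl[of x] x by simp
      qed
    qed
    moreover obtain x where "t = -2 * x" using ev even_neg by blast
    ultimately show False using tB B_dbl[of x] pos by auto
  qed
  have no: "y \<notin> B" if "y \<noteq> 0" "\<bar>y\<bar> < s" for y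
    using that
  proof (induction "nat \<bar>y\<bar>" arbitrary: y rule: less_induct)
    case less
    show ?case
    proof (cases "odd y")
      case True then show ?thesis using oddn[of y] less.prems st by auto
    next
      case False
      then obtain x where x: "y = -2 * x" using even_neg by blast
      then have "x \<notin> B" using less.hyps[of x] less.prems by auto
      then show ?thesis using B_dbl[of x] x by simp
    qed
  qed
  show ?thesis unfolding gap_def
  proof (intro conjI allI impI)
    show "0 < Z - z'" using z' by simp
    show "z' + (Z - z') \<in> B" using ZB[of 0] B_0 by simp
    fix j assume j: "0 < j \<and> j < Z - z'"
    have "z' + j = Z + (j - s)" by (simp add: s_def)
    moreover have "j - s \<notin> B" using no[of "j - s"] j by (auto simp: s_def)
    ultimately show "z' + j \<notin> B" using ZB[of "j - s"] by metis
  qed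
qed

lemma step_form: "step s = Lam (snd (step s)) \<or> step s = Rho (snd (step s))"
  by (cases s rule: step.cases) (auto simp: Lam_def Rho_def)

lemma Lam_eq_Lam_half: "Lam x = Lam_half (-2 * x)"
  unfolding Lam_half_def by (rule Lam_cong) (simp only: half_dbl)

lemma path_ex: "\<exists>e s'. path k s e s'"
  by (simp add: path_def)

lemma path_det: "path k s e s' \<Longrightarrow> path k s f s'' \<Longrightarrow> e = f \<and> s' = s''"
  by (auto simp: path_def)

lemma gap_unique:
  assumes "gap z g" "gap z g'"
  shows "g = g'"
  using assms unfolding gap_def by (meson linorder_neqE)

lemma reach_Lam_half_from_B:
  assumes "b \<in> B"
  shows "\<exists>k e z. z \<in> B \<and> path k (Rho b) e (Lam_half z)"
proof -
  obtain g where g: "gap (half * b) g" using gap_exists by blast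
  have 1: "path 1 (Rho b) 1 (Lam (half * b + 1))"
    using path_1[of "Rho b"] assms by (simp add: step_Rho weight_Rho)
  obtain k where "path k (Lam (half * b + 1)) 0 (Lam (half * b + g))"
    using excursion[OF _ g] assms by (auto simp: half_B)
  from path_trans[OF 1 this] have "path (1 + k) (Rho b) (1 + 0) (Lam_half (-2 * (half * b + g)))"
    by (simp add: Lam_eq_Lam_half)
  moreover have "-2 * (half * b + g) \<in> B" using g by (simp add: B_dbl gap_def del: mult_minus_left)
  ultimately show ?thesis by blast
qed

text \<open>The walk runs straight to the next element of \<open>B\<close>. On the left copy this
  state already has the required form; on the right copy the crossing there and an excursion lead to
  one.\<close>

lemma reach_Lam_half: "\<exists>k e z. z \<in> B \<and> path k s e (Lam_half z)"
proof -
  have L: "\<exists>k e z. z \<in> B \<and> path k (Lam x) e (Lam_half z)"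
    and R: "\<exists>k e z. z \<in> B \<and> path k (Rho x) e (Lam_half z)" for x
  proof -
    obtain g where g: "gap (x - 1) g" using gap_exists by blast
    define j where "j = g - 1"
    have j: "j \<ge> 0" "x + j \<in> B" and jn: "\<And>i. 0 \<le> i \<Longrightarrow> i < j \<Longrightarrow> x + i \<notin> B"
    proof -
      show "j \<ge> 0" "x + j \<in> B" using g by (auto simp: gap_def j_def algebra_simps)
      show "x + i \<notin> B" if "0 \<le> i" "i < j" for i
        using g that unfolding gap_def j_def by (auto dest!: spec[of _ "i + 1"])
    qed
    have Lam_half: "\<exists>k e z. z \<in> B \<and> path k (Lam (x + j)) e (Lam_half z)"
      using j by (intro exI[of _ 0] exI[of _ 0] exI[of _ "-2 * (x + j)"])
        (simp add: B_dbl Lam_eq_Lam_half path_0 del: mult_minus_left)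
    have P: "\<exists>k e z. z \<in> B \<and> path k (Rho (x + j)) e (Lam_half z)"
      using reach_Lam_half_from_B j by blast
    have ext: "\<exists>k e z. z \<in> B \<and> path k s e (Lam_half z)"
      if "path l s f s'" "\<exists>k e z. z \<in> B \<and> path k s' e (Lam_half z)" for s l f s'
      using that path_trans by blast
    show "\<exists>k e z. z \<in> B \<and> path k (Lam x) e (Lam_half z)" "\<exists>k e z. z \<in> B \<and> path k (Rho x) e (Lam_half z)"
    proof (atomize(full), cases "even j")
      case True
      then obtain m where m: "j = 2 * m" by (rule evenE)
      with j have "m \<ge> 0" by simp
      have np: "x + i \<notin> B" if "0 \<le> i" "i < 2 * int (nat m)" for i
        using jn that m \<open>m \<ge> 0\<close> by simp
      have "path (2 * nat m) (Lam x) 0 (Lam (x + j))" "path (2 * nat m) (Rho x) 0 (Rho (x + j))"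
        using run[of "nat m" x, OF np] m \<open>m \<ge> 0\<close> by simp_all
      from ext[OF this(1) Lam_half] ext[OF this(2) P]
      show "(\<exists>k e z. z \<in> B \<and> path k (Lam x) e (Lam_half z)) \<and> (\<exists>k e z. z \<in> B \<and> path k (Rho x) e (Lam_half z))" ..
    next
      case False
      then obtain m where m: "j = 2 * m + 1" by (rule oddE)
      with j have "m \<ge> 0" by simp
      have np: "x + i \<notin> B" if "0 \<le> i" "i < 2 * int (nat m) + 1" for i
        using jn that m \<open>m \<ge> 0\<close> by simp
      have r: "x + 2 * int (nat m) + 1 = x + j" using m \<open>m \<ge> 0\<close> by simp
      from ext[OF run_odd(1)[of "nat m" x, OF np, unfolded r] P]
        ext[OF run_odd(2)[of "nat m" x, OF np, unfolded r] Lam_half]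
      show "(\<exists>k e z. z \<in> B \<and> path k (Lam x) e (Lam_half z)) \<and> (\<exists>k e z. z \<in> B \<and> path k (Rho x) e (Lam_half z))" by blast
    qed
  qed
  \<comment> \<open>The coordinate of \<open>s\<close> need not be reduced modulo \<open>n\<close>,
    but that of its successor is.\<close>
  have "\<exists>k e z. z \<in> B \<and> path k (step s) e (Lam_half z)" using step_form[of s] L R by metis
  then show ?thesis using path_trans[OF path_1[of s]] by blast
qed

text \<open>The last conjunct records that the move visits, on the right copy, the next element of
  \<open>B\<close> above \<open>z\<close>. This is how the walk meets a multiple of \<open>n\<close>
  that the chain has jumped over.\<close>

definition descends :: "int \<Rightarrow> int \<Rightarrow> bool" where
  "descends z z' \<longleftrightarrow> z' < z \<and> odd (z - z') \<and> (\<forall>y. z' < y \<and> y < z \<and> odd (z - y) \<longrightarrow> y \<notin> B)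
     \<and> (\<exists>k g e. gap z g \<and> path k (Lam_half z) e (Rho (z + g)))"

lemma chain:
  assumes "z0 \<in> B"
  shows "\<exists>zs es. zs 0 = z0 \<and> (\<forall>m. zs m \<in> B \<and> (\<exists>k>0. path k (Lam_half (zs m)) (es m) (Lam_half (zs (Suc m)))) \<and>
    (es m = -1 \<or> es m = 0 \<and> descends (zs m) (zs (Suc m))))"
proof -
  have "\<forall>z\<in>B. \<exists>z' e. z' \<in> B \<and> (\<exists>k>0. path k (Lam_half z) e (Lam_half z')) \<and> (e = -1 \<or> e = 0 \<and> descends z z')"
  proof
    fix z assume z: "z \<in> B"
    obtain g where g: "gap z g" using gap_exists by blast
    show "\<exists>z' e. z' \<in> B \<and> (\<exists>k>0. path k (Lam_half z) e (Lam_half z')) \<and> (e = -1 \<or> e = 0 \<and> descends z z')"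
    proof (cases "even g")
      case True
      then have "\<exists>k>0. path k (Lam_half z) (-1) (Lam_half (-2 * (z + g)))" using chain_step[OF z g] by blast
      moreover have "-2 * (z + g) \<in> B" using g by (simp add: B_dbl gap_def del: mult_minus_left)
      ultimately show ?thesis by blast
    next
      case False
      then have 1: "\<exists>k>0. \<exists>e. path k (Lam_half z) e (Rho (z + g))"
        and 2: "\<exists>k>0. \<exists>z'\<in>B. path k (Lam_half z) 0 (Lam_half z') \<and> z' < z \<and> odd (z - z') \<and>
          (\<forall>y. z' < y \<and> y < z \<and> odd (z - y) \<longrightarrow> y \<notin> B)"
        using chain_step[OF z g] by blast+
      then show ?thesis using g unfolding descends_def by blast
    qed
  qed
  then obtain nx ex where nx: "\<And>z. z \<in> B \<Longrightarrow> nx z \<in> B \<and> (\<exists>k>0. path k (Lam_half z) (ex z) (Lam_half (nx z))) \<and>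
      (ex z = -1 \<or> ex z = 0 \<and> descends z (nx z))"
    by metis
  have "(nx ^^ m) z0 \<in> B" for m by (induction m) (use nx assms in auto)
  then show ?thesis
    by (intro exI[of _ "\<lambda>m. (nx ^^ m) z0"] exI[of _ "\<lambda>m. ex ((nx ^^ m) z0)"]) (use nx in auto)
qed

lemma chain_path:
  assumes "\<And>m. \<exists>k>0. path k (Lam_half (zs m)) (es m) (Lam_half (zs (Suc m)))"
  shows "m < m' \<Longrightarrow> \<exists>k>0. path k (Lam_half (zs m)) (\<Sum>i\<in>{m..<m'}. es i) (Lam_half (zs m'))"
proof (induction m' rule: less_induct)
  case (less m')
  then obtain l where l: "m' = Suc l" "m \<le> l" by (cases m') auto
  obtain k where k: "k > 0" "path k (Lam_half (zs l)) (es l) (Lam_half (zs (Suc l)))" using assms by blast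
  show ?case
  proof (cases "m = l")
    case True
    then show ?thesis using k l by auto
  next
    case False
    then obtain k' where "path k' (Lam_half (zs m)) (\<Sum>i\<in>{m..<l}. es i) (Lam_half (zs l))"
      using less.IH[of l] l by auto
    from path_trans[OF this k(2)] k(1) l show ?thesis
      by (intro exI[of _ "k' + k"]) (simp add: add.commute)
  qed
qed

section \<open>Closed loops of the walk and their weight\<close>

lemma repeated_residue:
  fixes zs :: "nat \<Rightarrow> int"
  assumes "infinite M"
  shows "\<exists>m\<in>M. \<exists>m'\<in>M. m < m' \<and> zs m mod n = zs m' mod n"
proof -
  have "finite ((\<lambda>m. zs m mod n) ` M)"
    by (rule finite_subset[of _ "{0..<n}"]) (use n_pos in auto)
  then obtain a where a: "a \<in> M" "infinite {m \<in> M. zs m mod n = zs a mod n}"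
    using pigeonhole_infinite[OF assms] by blast
  then have "infinite ({m \<in> M. zs m mod n = zs a mod n} - {a})" by simp
  then obtain b where "b \<in> {m \<in> M. zs m mod n = zs a mod n} - {a}" by (metis ex_in_conv finite.emptyI)
  then show ?thesis using a by (metis (mono_tags, lifting) DiffE linorder_neqE_nat mem_Collect_eq singletonI)
qed

text \<open>The walk is deterministic: going round the loop and then to \<open>t\<close> is the same
  as going to \<open>t\<close> and then making \<open>K\<close> more steps.\<close>

lemma loop_shift:
  assumes "path K s W s" "path a s e t"
  shows "path K t W t"
proof -
  obtain w u where u: "path K t w u" using path_ex by blast
  have "path (a + K) s (e + w) u" using path_trans assms u by blast
  moreover have "path (a + K) s (W + e) t" using path_trans[OF assms] by (simp add: add.commute)
  ultimately show ?thesis using path_det[of "a + K" s] u by fastforce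
qed

lemma loop_power:
  assumes "path K s W s"
  shows "path (N * K) s (int N * W) s"
proof (induction N)
  case 0 show ?case by (simp add: path_0)
next
  case (Suc N)
  from path_trans[OF assms Suc] show ?case by (simp add: algebra_simps)
qed

text \<open>Along the states \<open>Lam_half z\<close> with \<open>z \<in> B\<close> the weight never increases. As the time reversal of the walk is
  the walk for \<open>-B\<close> with negated weights, closed loops have weight zero.\<close>

lemma loop_nonpos:
  assumes "K > 0" "path K s W s"
  shows "W \<le> 0"
proof -
  obtain a e z where z: "z \<in> B" "path a s e (Lam_half z)" using reach_Lam_half by blast
  obtain zs es where c: "\<And>m. zs m \<in> B" "\<And>m. \<exists>k>0. path k (Lam_half (zs m)) (es m) (Lam_half (zs (Suc m)))"
    "\<And>m. es m = -1 \<or> es m = 0" "zs 0 = z" using chain[OF z(1)] by metis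
  obtain m m' where m: "m < m'" "zs m mod n = zs m' mod n" using repeated_residue[of UNIV zs] by auto
  obtain k where k: "k > 0" "path k (Lam_half (zs m)) (\<Sum>i\<in>{m..<m'}. es i) (Lam_half (zs m))"
    using chain_path[of zs es m m', OF c(2) m(1)] Lam_half_cong[OF m(2)] by auto
  have le: "(\<Sum>i\<in>{m..<m'}. es i) \<le> 0" using c(3) by (intro sum_nonpos) (metis dual_order.refl neg_le_0_iff_le zero_le_one)
  have "\<exists>a e. path a s e (Lam_half (zs m))"
  proof (cases m)
    case 0 then show ?thesis using z c(4) by auto
  next
    case (Suc l)
    then obtain k where "path k (Lam_half (zs 0)) (\<Sum>i\<in>{0..<m}. es i) (Lam_half (zs m))"
      using chain_path[of zs es 0 m, OF c(2)] by auto
    then show ?thesis using path_trans z(2) c(4) by blast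
  qed
  then have "path K (Lam_half (zs m)) W (Lam_half (zs m))" using loop_shift[OF assms(2)] by blast
  \<comment> \<open>Both closed loops at this state, repeated to the common length
    \<open>k * K\<close>, have the same weight.\<close>
  from loop_power[OF this, of k] loop_power[OF k(2), of K]
  have "int k * W = int K * (\<Sum>i\<in>{m..<m'}. es i)" by (simp add: path_det mult.commute[of k K])
  also have "\<dots> \<le> 0" using le by (simp add: mult_nonneg_nonpos)
  finally show ?thesis using k(1) by (simp add: mult_le_0_iff)
qed

text \<open>The state is moved across and then negated. A step of the walk for the negative of
  \<open>B\<close> first crosses back; adding 1 then undoes, under the negation, the shift of the
  original step.\<close>

definition reversal :: "bool \<times> int \<Rightarrow> bool \<times> int" where
  "reversal s = (if fst s then Lam (- (if snd s \<in> B then half * snd s else snd s))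
           else Rho (- (if snd s \<in> B then -2 * snd s else snd s)))"

lemma reversal_Lam: "reversal (Lam x) = Rho (- (if x \<in> B then -2 * x else x))"
proof -
  have "(- (-2 * (x mod n))) mod n = (- (-2 * x)) mod n" by (metis mod_minus_eq mod_mult_right_eq)
  moreover have "(- (x mod n)) mod n = (- x) mod n" by (metis mod_minus_eq)
  ultimately show ?thesis by (simp add: reversal_def Lam_def Rho_def B_mod)
qed

lemma reversal_Rho: "reversal (Rho x) = Lam (- (if x \<in> B then half * x else x))"
proof -
  have "(- (half * (x mod n))) mod n = (- (half * x)) mod n" by (metis mod_minus_eq mod_mult_right_eq)
  moreover have "(- (x mod n)) mod n = (- x) mod n" by (metis mod_minus_eq)
  ultimately show ?thesis by (simp add: reversal_def Lam_def Rho_def B_mod)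
qed

lemma band_walk_uminus: "band_walk n {x. - x \<in> B}"
proof
  fix x
  show "x mod n \<in> {x. - x \<in> B} \<longleftrightarrow> x \<in> {x. - x \<in> B}"
    using B_cong[of "- (x mod n)" "- x"] by (simp add: mod_minus_eq)
  show "-2 * x \<in> {x. - x \<in> B} \<longleftrightarrow> x \<in> {x. - x \<in> B}"
    using B_dbl[of "- x"] by simp
qed (use odd_n n_pos B_0 in auto)

interpretation rev: band_walk n "{x. - x \<in> B}"
  by (rule band_walk_uminus)

lemma half_neg_dbl: "(2 * (half * x)) mod n = (- x) mod n"
  using mod_minus_cong[OF dbl_half[of x]] by simp

lemma reversal_step_Lam: "rev.step (reversal (step (Lam x))) = reversal (Lam x)"
proof -
  define y where "y = (if x \<in> B then -2 * x else x) + 1"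
  have "step (Lam x) = Rho y" by (simp add: step_Lam y_def)
  moreover have "rev.step (reversal (Rho y)) = Rho (1 - y)"
  proof (cases "y \<in> B")
    case True
    have "(2 * (half * y) + 1) mod n = (1 - y) mod n"
      using mod_add_cong[OF half_neg_dbl[of y] refl, of 1] by (simp add: algebra_simps)
    from Rho_cong[OF this] show ?thesis using True
      by (simp add: reversal_Rho rev.step_Lam half_B)
  next
    case False
    then show ?thesis by (simp add: reversal_Rho rev.step_Lam)
  qed
  moreover have "Rho (1 - y) = reversal (Lam x)" by (simp add: reversal_Lam y_def)
  ultimately show ?thesis by metis
qed

lemma reversal_step_Rho: "rev.step (reversal (step (Rho x))) = reversal (Rho x)"
proof -
  define y where "y = (if x \<in> B then half * x else x) + 1"
  have "step (Rho x) = Lam y" by (simp add: step_Rho y_def)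
  moreover have "rev.step (reversal (Lam y)) = Lam (1 - y)"
  proof (cases "y \<in> B")
    case True
    have "(half * (2 * y) + 1) mod n = (1 - y) mod n"
      using mod_add_cong[OF half_dbl[of "-y"] refl, of 1] by (simp add: algebra_simps)
    note * = Lam_cong[OF this]
    have "- (2 * y) \<in> B" using B_dbl[of y] True by simp
    with * show ?thesis using True
      by (simp add: reversal_Lam rev.step_Rho)
  next
    case False
    then show ?thesis by (simp add: reversal_Lam rev.step_Rho)
  qed
  moreover have "Lam (1 - y) = reversal (Rho x)" by (simp add: reversal_Rho y_def)
  ultimately show ?thesis by metis
qed

lemma reversal_weight_Lam: "rev.weight (reversal (Lam x)) = - weight (Lam x)"
  using B_dbl[of x] by (simp add: reversal_Lam rev.weight_Rho weight_Lam)

lemma reversal_weight_Rho: "rev.weight (reversal (Rho x)) = - weight (Rho x)"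
  by (simp add: reversal_Rho rev.weight_Lam weight_Rho half_B)

text \<open>The step that leads back from one state to its predecessor is taken at the reversal of
  the later state, hence the index \<open>Suc j\<close>. Around a closed loop the shift of the index
  does not change the sum.\<close>

lemma rev_path:
  assumes "s = Lam x \<or> s = Rho x"
  shows "rev.path k (reversal ((step ^^ k) s)) (- (\<Sum>j<k. weight ((step ^^ Suc j) s))) (reversal s)"
proof (induction k)
  case 0
  then show ?case by (simp add: rev.path_0)
next
  case (Suc k)
  define t where "t = (step ^^ k) s"
  have "\<exists>x. t = Lam x \<or> t = Rho x"
  proof (cases k)
    case 0 then show ?thesis using assms by (auto simp: t_def)
  next
    case (Suc l) then show ?thesis using step_form[of "(step ^^ l) s"] by (simp add: t_def) blast
  qed
  then have "rev.step (reversal (step t)) = reversal t" using reversal_step_Lam reversal_step_Rho by blast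
  moreover have "rev.weight (reversal (step t)) = - weight (step t)"
    using step_form[of t] reversal_weight_Lam reversal_weight_Rho by metis
  ultimately have "rev.path 1 (reversal (step t)) (- weight (step t)) (reversal t)"
    using rev.path_1 by metis
  from rev.path_trans[OF this Suc[folded t_def]] show ?case
    by (simp add: t_def algebra_simps)
qed

lemma loop_zero:
  assumes "K > 0" "path K s W s"
  shows "W = 0"
proof -
  obtain l where l: "K = Suc l" using assms by (cases K) auto
  then have "s = step ((step ^^ l) s)" using assms by (simp add: path_def)
  then obtain x where x: "s = Lam x \<or> s = Rho x" using step_form by metis
  have "(\<Sum>j<k. weight ((step ^^ Suc j) s)) + weight s = (\<Sum>j<k. weight ((step ^^ j) s)) + weight ((step ^^ k) s)" for k
    by (induction k) auto
  from this[of K] have "(\<Sum>j<K. weight ((step ^^ Suc j) s)) = W" and "(step ^^ K) s = s"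
    using assms by (auto simp: path_def)
  then have "rev.path K (reversal s) (- W) (reversal s)" using rev_path[OF x, of K] by simp
  then have "- W \<le> 0" using rev.loop_nonpos[OF assms(1)] by blast
  then show ?thesis using loop_nonpos[OF assms] by simp
qed

text \<open>Since loops have weight zero, the chain of states \<open>Lam_half z\<close> with \<open>z \<in> B\<close> eventually only descends; when it
  passes a multiple of \<open>n\<close> without meeting it from the left, it meets it from the right.\<close>

theorem hits_zero: "\<exists>k. (step ^^ k) s = Lam 0 \<or> (step ^^ k) s = Rho 0"
proof -
  define hit where "hit s \<longleftrightarrow> (\<exists>k. (step ^^ k) s = Lam 0 \<or> (step ^^ k) s = Rho 0)" for s
  have hitI: "hit s" if "path k s e t" "hit t" for k s e t
    using that unfolding hit_def path_def by (metis funpow_add comp_apply)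
  have hit0: "hit (Lam 0)" "hit (Rho 0)" unfolding hit_def by (metis funpow_0)+
  obtain a e z where z: "z \<in> B" "path a s e (Lam_half z)" using reach_Lam_half by blast
  obtain zs es where zB: "\<And>m. zs m \<in> B" and st: "\<And>m. \<exists>k>0. path k (Lam_half (zs m)) (es m) (Lam_half (zs (Suc m)))"
    and es: "\<And>m. es m = -1 \<or> es m = 0 \<and> descends (zs m) (zs (Suc m))" and z0: "zs 0 = z"
    using chain[OF z(1)] by metis
  have hit_Lam_half: "hit (Lam_half z)" if "hit (Lam_half (zs m))" for m
  proof (cases m)
    case 0 then show ?thesis using that z0 by simp
  next
    case (Suc l)
    then obtain k where "path k (Lam_half (zs 0)) (\<Sum>i\<in>{0..<m}. es i) (Lam_half (zs m))"
      using chain_path[of zs es 0 m, OF st] by auto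
    then show ?thesis using hitI that z0 by blast
  qed
  \<comment> \<open>Two such positions with equal residues would enclose a closed loop of negative
    weight.\<close>
  have "finite {m. es m = -1}"
  proof (rule ccontr)
    assume "infinite {m. es m = -1}"
    then obtain m m' where m: "es m = -1" "m < m'" "zs m mod n = zs m' mod n"
      using repeated_residue[of "{m. es m = -1}" zs] by auto
    obtain k where k: "k > 0" "path k (Lam_half (zs m)) (\<Sum>i\<in>{m..<m'}. es i) (Lam_half (zs m))"
      using chain_path[of zs es m m', OF st m(2)] Lam_half_cong[OF m(3)] by auto
    have "(\<Sum>i\<in>{m..<m'}. es i) = es m + (\<Sum>i\<in>{Suc m..<m'}. es i)"
      using m by (simp add: sum.atLeast_Suc_lessThan)
    moreover have "(\<Sum>i\<in>{Suc m..<m'}. es i) \<le> 0"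
      by (intro sum_nonpos) (metis es dual_order.refl neg_le_0_iff_le zero_le_one)
    ultimately show False using loop_zero[OF k] m by simp
  qed
  then obtain M where M: "\<And>m. m \<ge> M \<Longrightarrow> es m \<noteq> -1"
    by (metis (mono_tags, lifting) finite_nat_set_iff_bounded mem_Collect_eq not_le)
  then have D: "descends (zs m) (zs (Suc m))" if "m \<ge> M" for m using es[of m] that by auto
  have dec: "zs (M + i) \<le> zs M - int i" for i
  proof (induction i)
    case (Suc i) then show ?case using D[of "M + i"] by (auto simp: descends_def)
  qed simp
  \<comment> \<open>The largest multiple of \<open>n\<close> strictly below
    \<open>zs M\<close>.\<close>
  define Z where "Z = n * ((zs M - 1) div n)"
  have "Z = zs M - 1 - (zs M - 1) mod n" unfolding Z_def by (simp add: minus_mod_eq_mult_div)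
  then have Zlt: "Z < zs M" using pos_mod_sign[OF n_pos, of "zs M - 1"] by linarith
  have "zs (M + nat (zs M - Z)) \<le> Z" using dec[of "nat (zs M - Z)"] Zlt by simp
  then have ex: "\<exists>i. zs (M + i) \<le> Z" by blast
  define i where "i = (LEAST i. zs (M + i) \<le> Z)"
  have i: "zs (M + i) \<le> Z" unfolding i_def using ex by (rule LeastI_ex)
  then obtain l where l: "i = Suc l" using Zlt by (cases i) auto
  have lt: "zs (M + l) > Z" using not_less_Least[of l "\<lambda>i. zs (M + i) \<le> Z"] l unfolding i_def by simp
  have d: "descends (zs (M + l)) (zs (M + i))" using D[of "M + l"] l by simp
  have "hit (Lam_half (zs (M + i)))"
  proof (cases "zs (M + i) = Z")
    case True
    have "half * Z mod n = 0 mod n" by (simp add: Z_def mult.left_commute)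
    then have "Lam_half Z = Lam 0" unfolding Lam_half_def by (rule Lam_cong)
    then show ?thesis using True hit0 by simp
  next
    case False
    then have "gap (zs (M + i)) (Z - zs (M + i))"
      using crossing[of Z "zs (M + l)" "zs (M + i)"] i lt d zB unfolding descends_def by (simp add: Z_def)
    \<comment> \<open>The following descent visits the right copy at the next element of
      \<open>B\<close> above \<open>zs (M + i)\<close>, which by \<open>crossing\<close> is
      \<open>Z\<close>.\<close>
    moreover have "descends (zs (M + i)) (zs (Suc (M + i)))" using D by simp
    then obtain k g e where "gap (zs (M + i)) g" "path k (Lam_half (zs (M + i))) e (Rho (zs (M + i) + g))"
      unfolding descends_def by blast
    ultimately have "path k (Lam_half (zs (M + i))) e (Rho Z)" using gap_unique by fastforce
    moreover have "Rho Z = Rho 0" by (rule Rho_cong) (simp add: Z_def)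
    ultimately show ?thesis using hitI hit0 by metis
  qed
  then show ?thesis using hit_Lam_half hitI z(2) unfolding hit_def by blast
qed

end

section \<open>The row permutation is a single cycle\<close>

lemma funpow_mem: "bij_betw f S S \<Longrightarrow> x \<in> S \<Longrightarrow> (f ^^ k) x \<in> S"
  using bij_betw_funpow[of f S k] by (auto simp: bij_betw_def)

lemma funpow_return:
  assumes "finite S" "bij_betw f S S" "a \<in> S"
  shows "\<exists>d>0. (f ^^ d) a = a"
proof -
  have "finite (range (\<lambda>k. (f ^^ k) a))"
    by (rule finite_subset[OF _ assms(1)]) (use funpow_mem[OF assms(2,3)] in auto)
  then have "\<not> inj (\<lambda>k. (f ^^ k) a)" using finite_imageD infinite_UNIV_nat by blast
  then obtain i j where ij: "i < j" "(f ^^ i) a = (f ^^ j) a"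
    unfolding inj_def by (metis linorder_neqE_nat)
  then have "(f ^^ i) ((f ^^ (j - i)) a) = (f ^^ i) a"
    by (metis comp_apply funpow_add le_add_diff_inverse less_imp_le)
  moreover have "inj_on (f ^^ i) S" using bij_betw_funpow[OF assms(2)] bij_betw_def by blast
  ultimately have "(f ^^ (j - i)) a = a"
    using assms(3) funpow_mem[OF assms(2,3)] by (meson inj_onD)
  then show ?thesis using ij by (intro exI[of _ "j - i"]) simp
qed

lemma funpow_mult_fix: "(f ^^ d) a = a \<Longrightarrow> (f ^^ (d * m)) a = a"
  by (induction m) (auto simp: funpow_add)

lemma funpow_reach_sym:
  assumes "finite S" "bij_betw f S S" "a \<in> S" "(f ^^ k) a = b"
  shows "\<exists>l. (f ^^ l) b = a"
proof -
  obtain d where d: "d > 0" "(f ^^ d) a = a" using funpow_return[OF assms(1-3)] by blast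
  have "k \<le> d * k" using d by simp
  then have "(f ^^ (d * k - k)) b = a"
    using funpow_mult_fix[OF d(2), of k] assms(4)
    by (metis comp_apply funpow_add le_add_diff_inverse2)
  then show ?thesis ..
qed

lemma single_cycle:
  assumes S: "finite S" "bij_betw f S S" and a: "a \<in> S" and r: "\<And>x. x \<in> S \<Longrightarrow> \<exists>k. (f ^^ k) x = a"
  shows "x \<in> S \<Longrightarrow> (f ^^ card S) x = x"
    and "x \<in> S \<Longrightarrow> y \<in> S \<Longrightarrow> \<exists>k. (f ^^ k) x = y"
proof -
  have reach: "\<exists>k. (f ^^ k) x = y" if "x \<in> S" "y \<in> S" for x y
  proof -
    obtain k l where "(f ^^ k) x = a" "(f ^^ l) y = a" using r \<open>x \<in> S\<close> \<open>y \<in> S\<close> by blast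
    moreover then obtain m where "(f ^^ m) a = y" using funpow_reach_sym[OF S \<open>y \<in> S\<close>] by blast
    ultimately show ?thesis by (metis comp_apply funpow_add)
  qed
  show "x \<in> S \<Longrightarrow> y \<in> S \<Longrightarrow> \<exists>k. (f ^^ k) x = y" by (rule reach)
  define d where "d = (LEAST d. d > 0 \<and> (f ^^ d) a = a)"
  have d: "d > 0 \<and> (f ^^ d) a = a" unfolding d_def using funpow_return[OF S a] by (rule LeastI_ex)
  have dmin: "(f ^^ i) a \<noteq> a" if "0 < i" "i < d" for i
    using not_less_Least[of i "\<lambda>d. d > 0 \<and> (f ^^ d) a = a"] that unfolding d_def[symmetric] by auto
  have modd: "(f ^^ i) a = (f ^^ (i mod d)) a" for i
    using funpow_mult_fix[of d f a "i div d"] d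
    by (metis comp_apply funpow_add mod_mult_div_eq)
  have "inj_on (\<lambda>i. (f ^^ i) a) {..<d}"
  proof (rule linorder_inj_onI')
    fix i j assume ij: "i \<in> {..<d}" "j \<in> {..<d}" "i < j"
    show "(f ^^ i) a \<noteq> (f ^^ j) a"
    proof
      assume e: "(f ^^ i) a = (f ^^ j) a"
      have "(f ^^ (d - j)) ((f ^^ i) a) = (f ^^ (d - j)) ((f ^^ j) a)" using e by simp
      then have "(f ^^ (d - j + i)) a = (f ^^ (d - j + j)) a" by (simp add: funpow_add)
      then have "(f ^^ (d - j + i)) a = a" using ij d by simp
      moreover have "0 < d - j + i" "d - j + i < d" using ij by auto
      note dmin[OF this]
      ultimately show False by contradiction
    qed
  qed
  moreover have "(\<lambda>i. (f ^^ i) a) ` {..<d} = S"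
  proof
    show "(\<lambda>i. (f ^^ i) a) ` {..<d} \<subseteq> S" using funpow_mem[OF S(2) a] by auto
    show "S \<subseteq> (\<lambda>i. (f ^^ i) a) ` {..<d}"
    proof
      fix x assume "x \<in> S"
      then obtain k where "(f ^^ k) a = x" using reach[OF a] by blast
      then show "x \<in> (\<lambda>i. (f ^^ i) a) ` {..<d}" using modd[of k] d by auto
    qed
  qed
  ultimately have card: "card S = d" using card_image by fastforce
  assume "x \<in> S"
  then obtain k where k: "(f ^^ k) a = x" using reach[OF a] by blast
  have "(f ^^ d) ((f ^^ k) a) = (f ^^ k) ((f ^^ d) a)" by (metis add.commute comp_apply funpow_add)
  then show "(f ^^ card S) x = x" using k d card by simp
qed

lemma sign_on_funpow:
  assumes "finite S" "bij_betw f S S"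
  shows "sign_on S (f ^^ k) = sign_on S f ^ k"
proof (induction k)
  case (Suc k)
  then show ?case
    using sign_on_compose[OF assms(2) bij_betw_funpow[OF assms(2), of k] assms(1)] by (simp add: funpow.simps)
qed (simp add: id_def)

text \<open>If \<open>a\<close> and \<open>b\<close> were in different cycles, composing with their transposition would merge them into
  a single cycle of odd length, which is an even permutation.\<close>

lemma merge_cycles:
  assumes S: "finite S" "bij_betw f S S" "odd (card S)" and sgn: "sign_on S f = 1"
    and ab: "a \<in> S" "b \<in> S" and r: "\<And>x. x \<in> S \<Longrightarrow> \<exists>k. (f ^^ k) x = a \<or> (f ^^ k) x = b"
    and x: "x \<in> S"
  shows "\<exists>k. (f ^^ k) x = a"
proof (cases "\<exists>k. (f ^^ k) b = a")
  case True
  then show ?thesis using r[OF x] by (metis comp_apply funpow_add)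
next
  case False
  then have ne: "a \<noteq> b" by (metis funpow_0)
  have nab: "(f ^^ k) a \<noteq> b" for k using False funpow_reach_sym[OF S(1,2) ab(1)] by metis
  define g where "g = f \<circ> transpose a b"
  have tr: "bij_betw (transpose a b) S S" using ab by (intro bij_betwI[of _ _ _ "transpose a b"]) (auto simp: transpose_def)
  then have g: "bij_betw g S S" unfolding g_def using S(2) bij_betw_trans by blast
  have same: "(g ^^ k) x = (f ^^ k) x" if "\<And>i. i < k \<Longrightarrow> (f ^^ i) x \<notin> {a, b}" for k x
    using that
  proof (induction k)
    case (Suc k)
    then show ?case by (simp add: g_def transpose_def)
  qed simp
  have first: "\<exists>k. (f ^^ k) x \<in> {a, b} \<and> (g ^^ k) x = (f ^^ k) x" if "x \<in> S" for x
  proof -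
    define k where "k = (LEAST k. (f ^^ k) x \<in> {a, b})"
    have ex: "\<exists>k. (f ^^ k) x \<in> {a, b}" using r[OF that] by simp
    have 1: "(f ^^ k) x \<in> {a, b}" unfolding k_def by (rule LeastI_ex[OF ex])
    have 2: "(f ^^ i) x \<notin> {a, b}" if "i < k" for i
      by (rule not_less_Least[OF that[unfolded k_def]])
    show ?thesis using same[of k x, OF 2] 1 by blast
  qed
  have fa: "f a \<in> S" using S(2) ab by (auto simp: bij_betw_def)
  \<comment> \<open>The map \<open>g\<close> sends \<open>b\<close> to \<open>f a\<close>, whose
    orbit under \<open>f\<close> returns to \<open>a\<close> without meeting
    \<open>b\<close>.\<close>
  have gb: "\<exists>k. (g ^^ k) b = a"
  proof -
    obtain k where k: "(f ^^ k) (f a) \<in> {a, b}" "(g ^^ k) (f a) = (f ^^ k) (f a)" using first[OF fa] by blast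
    have "(f ^^ k) (f a) \<noteq> b" using nab[of "Suc k"] by (simp add: funpow_swap1)
    then have "(g ^^ k) (g b) = a" using k by (simp add: g_def)
    then show ?thesis by (metis comp_apply funpow_Suc_right)
  qed
  have "\<exists>k. (g ^^ k) x = a" if "x \<in> S" for x
  proof -
    obtain k where k: "(f ^^ k) x \<in> {a, b}" "(g ^^ k) x = (f ^^ k) x" using first[OF \<open>x \<in> S\<close>] by blast
    obtain l where l: "(g ^^ l) b = a" using gb by blast
    have "(g ^^ (l + k)) x = a" if "(f ^^ k) x = b" using that k l by (simp add: funpow_add)
    then show ?thesis using k by auto
  qed
  then have "(g ^^ card S) x = x" if "x \<in> S" for x using single_cycle(1)[OF S(1) g ab(1)] that by blast
  then have "sign_on S (g ^^ card S) = sign_on S id" by (intro sign_on_cong) auto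
  then have "sign_on S g ^ card S = 1" using sign_on_funpow[OF S(1) g] by simp
  moreover have "sign_on S g = -1"
    unfolding g_def using sign_on_compose[OF S(2) tr S(1)] sign_on_transpose[OF ab ne] sgn by simp
  ultimately show ?thesis using S(3) by simp
qed

section \<open>Two steps of the walk as a permutation of the residues\<close>

context band_walk
begin

definition twist_mod :: "int \<Rightarrow> int" where "twist_mod x = (if x \<in> B then (-2 * x) mod n else x)"
definition untwist_mod :: "int \<Rightarrow> int" where "untwist_mod x = (if x \<in> B then (half * x) mod n else x)"
definition row :: "int \<Rightarrow> int" where "row x = (untwist_mod ((twist_mod x + 1) mod n) + 1) mod n"

lemma twist_mod_inv: "x \<in> {0..<n} \<Longrightarrow> untwist_mod (twist_mod x) = x" "x \<in> {0..<n} \<Longrightarrow> twist_mod (untwist_mod x) = x"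
proof -
  have 1: "(-2 * x) mod n \<in> B \<longleftrightarrow> x \<in> B" for x using B_mod[of "-2 * x"] B_dbl[of x] by simp
  have 2: "(half * x) mod n \<in> B \<longleftrightarrow> x \<in> B" for x using B_mod[of "half * x"] half_B[of x] by simp
  show "untwist_mod (twist_mod x) = x" if "x \<in> {0..<n}"
    unfolding twist_mod_def untwist_mod_def using that 1[of x] half_dbl[of x] by (auto simp only: mod_mult_right_eq if_True if_False) auto
  show "twist_mod (untwist_mod x) = x" if "x \<in> {0..<n}"
    unfolding twist_mod_def untwist_mod_def using that 2[of x] dbl_half[of x] by (auto simp only: mod_mult_right_eq if_True if_False) auto
qed

lemma twist_mod_range: "x \<in> {0..<n} \<Longrightarrow> twist_mod x \<in> {0..<n}" "x \<in> {0..<n} \<Longrightarrow> untwist_mod x \<in> {0..<n}"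
  using n_pos by (auto simp: twist_mod_def untwist_mod_def)

lemma bij_twist_mod: "bij_betw twist_mod {0..<n} {0..<n}" "bij_betw untwist_mod {0..<n} {0..<n}"
proof -
  have f: "twist_mod \<in> {0..<n} \<rightarrow> {0..<n}" "untwist_mod \<in> {0..<n} \<rightarrow> {0..<n}"
    by (intro Pi_I twist_mod_range; assumption)+
  show "bij_betw twist_mod {0..<n} {0..<n}" by (rule bij_betwI[OF f twist_mod_inv])
  show "bij_betw untwist_mod {0..<n} {0..<n}" by (rule bij_betwI[OF f(2,1) twist_mod_inv(2,1)])
qed

lemma bij_shift: "bij_betw (\<lambda>x. (x + c) mod n) {0..<n} {0..<n}"
  by (rule bij_betwI[of _ _ _ "\<lambda>x. (x - c) mod n"]) (use n_pos in \<open>auto simp: mod_simps\<close>)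

lemma row_eq: "row = (\<lambda>x. (x + 1) mod n) \<circ> (untwist_mod \<circ> ((\<lambda>x. (x + 1) mod n) \<circ> twist_mod))"
  by (simp add: row_def fun_eq_iff)

lemma bij_row: "bij_betw row {0..<n} {0..<n}"
  unfolding row_eq by (intro bij_betw_trans[OF _ bij_shift] bij_betw_trans[OF _ bij_twist_mod(2)] bij_twist_mod bij_betw_trans[OF bij_twist_mod(1)])

lemma sign_row: "sign_on {0..<n} row = 1"
proof -
  note b = bij_twist_mod bij_shift[of 1]
  let ?s = "sign_on {0..<n}" and ?t = "\<lambda>x. (x + 1) mod n"
  have "?s (untwist_mod \<circ> twist_mod) = ?s id" by (intro sign_on_cong) (auto simp: twist_mod_inv)
  then have h: "?s untwist_mod * ?s twist_mod = 1" using sign_on_compose[OF b(2,1)] by simp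
  have c1: "bij_betw (?t \<circ> twist_mod) {0..<n} {0..<n}" and c2: "bij_betw (untwist_mod \<circ> (?t \<circ> twist_mod)) {0..<n} {0..<n}"
    using b bij_betw_trans by blast+
  have "?s row = ?s ?t * (?s untwist_mod * (?s ?t * ?s twist_mod))"
    unfolding row_eq sign_on_compose[OF b(3) c2 finite_atLeastLessThan_int]
      sign_on_compose[OF b(2) c1 finite_atLeastLessThan_int]
      sign_on_compose[OF b(3,1) finite_atLeastLessThan_int] ..
  also have "\<dots> = (?s ?t * ?s ?t) * (?s untwist_mod * ?s twist_mod)" by (simp only: mult_ac)
  finally show ?thesis using h by (simp add: sign_on_def)
qed

lemma step_step: "step (step (False, x)) = (False, row x)"
proof -
  have "step (False, x) = (True, (twist_mod x + 1) mod n)" by (simp add: twist_mod_def mod_add_left_eq)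
  moreover have "step (True, y) = (False, (untwist_mod y + 1) mod n)" for y by (simp add: untwist_mod_def mod_add_left_eq)
  ultimately show ?thesis by (simp only: row_def)
qed

lemma step_row: "(step ^^ (2 * k)) (False, x) = (False, (row ^^ k) x)"
  by (induction k arbitrary: x) (simp_all only: mult_0_right funpow_0 mult_Suc_right add_2_eq_Suc funpow.simps comp_apply step_step id_apply)

text \<open>Starting on the left, the walk is on the left at even times, where it follows
  \<open>row\<close>. If it meets 0 on the right copy instead, its next state is
  \<open>Lam 1\<close>.\<close>

lemma row_hits:
  assumes "x \<in> {0..<n}"
  shows "\<exists>k. (row ^^ k) x = 0 \<or> (row ^^ k) x = 1 mod n"
proof -
  obtain k where k: "(step ^^ k) (False, x) = Lam 0 \<or> (step ^^ k) (False, x) = Rho 0"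
    using hits_zero by blast
  show ?thesis
  proof (cases "even k")
    case True
    then obtain j where "k = 2 * j" by (rule evenE)
    then show ?thesis using k step_row[of j x] by (auto simp: Lam_def Rho_def)
  next
    case False
    then obtain j where j: "k = 2 * j + 1" by (rule oddE)
    then have "fst ((step ^^ k) (False, x))" using step_row[of j x] by simp
    then have "(step ^^ k) (False, x) = Rho 0" using k by (auto simp: Lam_def)
    then have "step ((step ^^ k) (False, x)) = Lam 1" by (simp add: step_Rho B_0)
    then have "(step ^^ (2 * (j + 1))) (False, x) = Lam 1" using j by simp
    then have "(row ^^ (j + 1)) x = 1 mod n" unfolding step_row Lam_def by blast
    then show ?thesis by blast
  qed
qed

text \<open>Every cycle meets 0 or 1 because of the previous lemma, and a cycle count of two is excluded by
  the sign, \<open>row\<close> being even as a product in which each factor occurs together with a copy or its inverse.\<close>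

theorem row_cycle:
  assumes "x \<in> {0..<n}"
  shows "(row ^^ nat n) x = x" and "y \<in> {0..<n} \<Longrightarrow> \<exists>k. (row ^^ k) x = y"
proof -
  have o: "odd (card {0..<n})" using odd_n n_pos by (simp add: even_nat_iff)
  have ab: "0 \<in> {0..<n}" "1 mod n \<in> {0..<n}" using n_pos by auto
  have z: "\<exists>k. (row ^^ k) x = 0" if "x \<in> {0..<n}" for x
    using merge_cycles[OF _ bij_row o sign_row ab row_hits that] by simp
  show "(row ^^ nat n) x = x" "y \<in> {0..<n} \<Longrightarrow> \<exists>k. (row ^^ k) x = y"
    using single_cycle[OF _ bij_row ab(1) z] assms by simp_all
qed

end

section \<open>The powers of -2 modulo \<open>p\<close>\<close>

text \<open>The argument of Gauss's lemma: among the least absolute residues of \<open>-2j\<close>, \<open>1 \<le> j \<le> (p - 1)/2\<close>, exactly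
  those with \<open>2j \<le> (p - 1)/2\<close> are negative, and the number of these \<open>j\<close> is even.\<close>

lemma minus_two_power_half:
  fixes p :: nat
  assumes p: "prime p" "p > 3" and m: "p mod 8 = 1 \<or> p mod 8 = 3"
  shows "[(-2) ^ ((p - 1) div 2) = 1] (mod int p)"
proof -
  define h where "h = (p - 1) div 2"
  have "odd p" using p prime_odd_nat by auto
  then have ph: "p = 2 * h + 1" by (auto simp: h_def elim!: oddE)
  have h2: "even (h div 2)"
  proof -
    define k where "k = p div 8"
    have "p = 8 * k + 1 \<or> p = 8 * k + 3" using m mult_div_mod_eq[of 8 p, symmetric] unfolding k_def by metis
    then have "h = 2 * (2 * k) \<or> h = 2 * (2 * k) + 1" using ph by auto
    then have "h div 2 = 2 * k" by auto
    then show ?thesis by simp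
  qed
  define r where "r j = (if 2 * j \<le> h then 2 * j else p - 2 * j)" for j
  define s :: "nat \<Rightarrow> int" where "s j = (if 2 * j \<le> h then -1 else 1)" for j
  have c: "[-2 * int j = s j * int (r j)] (mod int p)" if "j \<in> {1..h}" for j
  proof (cases "2 * j \<le> h")
    case False
    then have "-2 * int j - s j * int (r j) = int p * (-1)" using that ph by (simp add: r_def s_def of_nat_diff)
    then show ?thesis unfolding cong_iff_dvd_diff by (rule dvdI)
  qed (simp add: r_def s_def)
  \<comment> \<open>The values \<open>2 * j\<close> are even and the values \<open>p - 2 * j\<close>
    odd, so the two cases cannot collide.\<close>
  have inj: "inj_on r {1..h}"
    by (auto simp: inj_on_def r_def ph split: if_splits) presburger+
  have "r ` {1..h} \<subseteq> {1..h}" by (auto simp: r_def ph)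
  then have img: "r ` {1..h} = {1..h}" using inj by (simp add: endo_inj_surj)
  have "(\<Prod>j\<in>{1..h}. int (r j)) = (\<Prod>j\<in>r ` {1..h}. int j)"
    using prod.reindex[OF inj, of int] by (simp add: comp_def)
  then have pr: "(\<Prod>j\<in>{1..h}. int (r j)) = fact h" unfolding img by (simp add: fact_prod)
  have "(\<Prod>j\<in>{1..h}. s j) = (\<Prod>j\<in>{1..h div 2}. s j) * (\<Prod>j\<in>{1..h} - {1..h div 2}. s j)"
    using prod.subset_diff[of "{1..h div 2}" "{1..h}" s] by (simp add: mult.commute)
  also have "(\<Prod>j\<in>{1..h div 2}. s j) = (\<Prod>j\<in>{1..h div 2}. -1)" by (intro prod.cong) (auto simp: s_def)
  also have "(\<Prod>j\<in>{1..h} - {1..h div 2}. s j) = 1" by (intro prod.neutral) (auto simp: s_def)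
  finally have ps: "(\<Prod>j\<in>{1..h}. s j) = 1" using h2 by simp
  have "(-2) ^ h * fact h = (\<Prod>j\<in>{1..h}. -2 * int j)" by (simp add: prod.distrib fact_prod del: mult_minus_left)
  also have "[\<dots> = (\<Prod>j\<in>{1..h}. s j * int (r j))] (mod int p)" by (rule cong_prod[OF c])
  also have "(\<Prod>j\<in>{1..h}. s j * int (r j)) = 1 * fact h" unfolding prod.distrib ps pr ..
  finally have "[(-2) ^ h * fact h = 1 * fact h] (mod int p)" .
  moreover have "coprime (fact h) (int p)"
  proof -
    have "\<not> p dvd fact h" using p(1) ph by (simp add: prime_dvd_fact_iff)
    then have "coprime p (fact h)" using p(1) by (simp add: prime_imp_coprime)
    then show ?thesis by (metis coprime_commute coprime_int_iff of_nat_fact)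
  qed
  ultimately show ?thesis using cong_mult_rcancel[of "fact h" "int p" "(-2) ^ h" 1] by (simp add: h_def)
qed

text \<open>With \<open>h = (p - 1) div 2\<close>, the \<open>h\<close>-th power of -2 is 1. So
  division by -2 is multiplication by a power of -2, and there are at most \<open>h\<close> powers
  among the \<open>2 * h\<close> nonzero residues.\<close>

lemma ex_band:
  fixes p :: nat
  assumes p: "prime p" "p > 3" and m: "p mod 8 = 1 \<or> p mod 8 = 3"
  shows "\<exists>B. band_walk (int p) B \<and> 1 \<notin> B \<and> (\<exists>b\<in>B. \<not> int p dvd b)"
proof -
  define h where "h = (p - 1) div 2"
  have "odd p" using p prime_odd_nat by auto
  then have ph: "p = 2 * h + 1" by (auto simp: h_def elim!: oddE)
  have one: "[(-2) ^ h = 1] (mod int p)" using minus_two_power_half[OF assms] by (simp add: h_def)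
  define A where "A = {x. \<exists>k. [x = (-2) ^ k] (mod int p)}"
  have dbl: "-2 * x \<in> A \<longleftrightarrow> x \<in> A" for x
  proof
    assume "x \<in> A"
    then obtain k where "[x = (-2) ^ k] (mod int p)" by (auto simp: A_def)
    then have "[-2 * x = (-2) ^ Suc k] (mod int p)" unfolding power_Suc by (rule cong_scalar_left)
    then show "-2 * x \<in> A" unfolding A_def by blast
  next
    assume "-2 * x \<in> A"
    then obtain k where k: "[-2 * x = (-2) ^ k] (mod int p)" by (auto simp: A_def)
    have "[1 * x = (-2) ^ h * x] (mod int p)" using one by (intro cong_scalar_right) (rule cong_sym)
    also have "(-2) ^ h * x = (-2) ^ (h - 1) * (-2 * x)"
      using ph p by (cases h) auto
    also have "[\<dots> = (-2) ^ (h - 1) * (-2) ^ k] (mod int p)" using k by (rule cong_scalar_left)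
    finally have "[x = (-2) ^ (h - 1 + k)] (mod int p)" by (simp add: power_add)
    then show "x \<in> A" unfolding A_def by blast
  qed
  have "\<not> int p dvd (-2) ^ k" for k
  proof
    assume "int p dvd (-2) ^ k"
    then have "int p dvd -2" using p(1) by (meson prime_dvd_power prime_nat_int_transfer)
    then have "int p dvd int 2" by simp
    then show False using p by (auto simp only: of_nat_dvd_iff dest!: dvd_imp_le)
  qed
  then have z: "0 \<notin> A" by (auto simp: A_def cong_0_iff cong_sym_eq[of 0])
  have "band_walk (int p) (- A)"
  proof
    show "odd (int p)" "int p > 0" "0 \<in> - A" using \<open>odd p\<close> p z by auto
    show "x mod int p \<in> - A \<longleftrightarrow> x \<in> - A" for x by (simp add: A_def)
    show "-2 * x \<in> - A \<longleftrightarrow> x \<in> - A" for x using dbl[of x] by simp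
  qed
  moreover have "1 \<in> A" unfolding A_def by (auto intro: exI[of _ 0])
  moreover have "\<exists>b\<in>- A. \<not> int p dvd b"
  proof (rule ccontr)
    assume "\<not> ?thesis"
    then have all: "b \<in> A" if "\<not> int p dvd b" for b using that by auto
    have "{1..<int p} \<subseteq> (\<lambda>k. (-2) ^ k mod int p) ` {..<h}"
    proof
      fix b assume b: "b \<in> {1..<int p}"
      then have "\<not> int p dvd b" using zdvd_not_zless by auto
      then obtain k where k: "[b = (-2) ^ k] (mod int p)" using all by (auto simp: A_def)
      have "[((-2) ^ h) ^ (k div h) * (-2) ^ (k mod h) = 1 ^ (k div h) * (-2) ^ (k mod h)] (mod int p)"
        by (intro cong_scalar_right cong_pow one)
      then have "[(-2) ^ k = (-2) ^ (k mod h)] (mod int p)"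
        by (simp flip: power_mult power_add)
      then have "[b = (-2) ^ (k mod h)] (mod int p)" using k cong_trans by blast
      then have "b = (-2) ^ (k mod h) mod int p" using b by (simp add: cong_def)
      moreover have "k mod h < h" using ph p by simp
      ultimately show "b \<in> (\<lambda>k. (-2) ^ k mod int p) ` {..<h}" by blast
    qed
    then have "card {1..<int p} \<le> h" by (metis card_lessThan finite_lessThan surj_card_le)
    then show False using ph p by simp
  qed
  ultimately show ?thesis by (intro exI[of _ "- A"]) auto
qed

section \<open>No isotopy to the cyclic group\<close>

text \<open>Conjugation by \<alpha> turns the translation by 1 into an affine map u to
  \<open>k * u + s\<close>. If \<open>k\<close> were not 1 this map would have a fixed point, which
  the translation has not. So it is a translation and \<alpha> is affine.\<close>

lemma shift_const:
  fixes \<alpha> \<beta> :: "int \<Rightarrow> int" and n :: int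
  assumes n: "prime n"
    and per: "\<And>x y. n dvd x - y \<Longrightarrow> n dvd \<alpha> x - \<alpha> y"
    and inj: "\<And>x y. n dvd \<alpha> x - \<alpha> y \<Longrightarrow> n dvd x - y"
    and sur: "\<And>u. \<exists>x. n dvd \<alpha> x - u"
    and k: "\<And>x x'. n dvd \<alpha> x' - \<alpha> x - 1 \<Longrightarrow> n dvd \<alpha> (x' + 1) - \<alpha> (x + 1) - k"
  shows "n dvd k - 1 \<and> (\<exists>s. \<forall>i. n dvd \<alpha> (int i) - \<alpha> 0 - s * int i)"
proof -
  obtain a where a: "\<And>u. n dvd \<alpha> (a u) - u" using sur by metis
  define s where "s = \<alpha> (a 0 + 1)"
  have lin: "n dvd \<alpha> (a (int u) + 1) - s - k * int u" for u
  proof (induction u)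
    case (Suc u)
    have "n dvd (\<alpha> (a (int (Suc u))) - int (Suc u)) - (\<alpha> (a (int u)) - int u)" by (rule dvd_diff[OF a a])
    then have "n dvd \<alpha> (a (int (Suc u))) - \<alpha> (a (int u)) - 1" by (simp add: algebra_simps)
    from dvd_add[OF k[OF this] Suc] show ?case by (simp add: algebra_simps)
  qed (simp add: s_def)
  have npos: "n > 1" using n by (simp add: prime_gt_1_int)
  have affine: "n dvd \<alpha> (x + 1) - s - k * \<alpha> x" for x
  proof -
    define u where "u = nat (\<alpha> x mod n)"
    have u: "n dvd \<alpha> x - int u" using npos by (simp add: u_def)
    have "n dvd (\<alpha> (a (int u)) - int u) - (\<alpha> x - int u)" by (rule dvd_diff[OF a u])
    then have "n dvd a (int u) - x" using inj by simp
    then have "n dvd \<alpha> (a (int u) + 1) - \<alpha> (x + 1)" using per by simp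
    note 1 = this
    have "n dvd (\<alpha> (a (int u) + 1) - s - k * int u) - (\<alpha> (a (int u) + 1) - \<alpha> (x + 1)) - k * (\<alpha> x - int u)"
      by (rule dvd_diff[OF dvd_diff[OF lin 1] dvd_mult[OF u]])
    then show ?thesis by (simp add: algebra_simps)
  qed
  have k1: "n dvd k - 1"
  proof (rule ccontr)
    assume "\<not> n dvd k - 1"
    then have "coprime n (k - 1)" using n prime_imp_coprime by blast
    then obtain w where "[(k - 1) * w = 1] (mod n)" using cong_solve_coprime_int by (metis coprime_commute)
    then have w: "n dvd (k - 1) * w - 1" by (simp add: cong_iff_dvd_diff)
    \<comment> \<open>The fixed point of the affine map, \<open>w\<close> being the inverse of
      \<open>k - 1\<close>.\<close>
    obtain x where x: "n dvd \<alpha> x - (- s * w)" using sur by blast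
    have "n dvd (\<alpha> (x + 1) - s - k * \<alpha> x) + (k - 1) * (\<alpha> x - (- s * w)) - s * ((k - 1) * w - 1)"
      by (rule dvd_diff[OF dvd_add[OF affine dvd_mult[OF x]] dvd_mult[OF w]])
    then have "n dvd \<alpha> (x + 1) - \<alpha> x" by (simp add: algebra_simps)
    then have "n dvd 1" using inj[of "x + 1" x] by simp
    then show False using npos by simp
  qed
  have "n dvd \<alpha> (int i) - \<alpha> 0 - s * int i" for i
  proof (induction i)
    case (Suc i)
    have "n dvd (\<alpha> (int i + 1) - s - k * \<alpha> (int i)) + \<alpha> (int i) * (k - 1) + (\<alpha> (int i) - \<alpha> 0 - s * int i)"
      by (rule dvd_add[OF dvd_add[OF affine dvd_mult[OF k1]] Suc])
    then show ?case by (simp add: algebra_simps)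
  qed simp
  then show ?thesis using k1 by blast
qed

text \<open>The last two assumptions make \<open>twist\<close> nonlinear: it fixes 1 but multiplies
  some nonzero residue by -2.\<close>

locale falconer_band = band_walk +
  assumes n_prime: "prime n" and n_gt_3: "n > 3" and B_1: "1 \<notin> B" and B_nz: "\<exists>b\<in>B. \<not> n dvd b"
begin

definition twist :: "int \<Rightarrow> int" where "twist d = (if d \<in> B then -2 * d else d)"

text \<open>The translation by 1 is an automorphism of \<open>x * y = x - twist (y - x)\<close>. Transported along an isotopy it becomes
  an autotopism of the cyclic group, hence affine, so that \<open>\<alpha>\<close>, \<open>\<beta>\<close>, \<open>\<gamma>\<close> are affine and \<open>twist\<close> is linear.\<close>

lemma no_additive_isotopy:
  fixes \<alpha> \<beta> \<gamma> :: "int \<Rightarrow> int"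
  assumes per: "\<And>x y. n dvd x - y \<Longrightarrow> n dvd \<alpha> x - \<alpha> y" "\<And>x y. n dvd x - y \<Longrightarrow> n dvd \<beta> x - \<beta> y"
      "\<And>x y. n dvd x - y \<Longrightarrow> n dvd \<gamma> x - \<gamma> y"
    and inj: "\<And>x y. n dvd \<alpha> x - \<alpha> y \<Longrightarrow> n dvd x - y" "\<And>x y. n dvd \<beta> x - \<beta> y \<Longrightarrow> n dvd x - y"
      "\<And>x y. n dvd \<gamma> x - \<gamma> y \<Longrightarrow> n dvd x - y"
    and sur: "\<And>u. \<exists>x. n dvd \<alpha> x - u" "\<And>u. \<exists>x. n dvd \<beta> x - u"
    and add: "\<And>x y. n dvd \<alpha> x + \<beta> y - \<gamma> (x - twist (y - x))"
  shows False
proof -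
  \<comment> \<open>The premise says that the product of \<open>x'\<close> and \<open>y\<close>
    agrees with that of \<open>x\<close> and \<open>y'\<close>; this persists when all four are
    increased by 1.\<close>
  have shift: "n dvd (\<alpha> (x' + 1) - \<alpha> (x + 1)) - (\<beta> (y' + 1) - \<beta> (y + 1))"
    if "n dvd (\<alpha> x' - \<alpha> x) - (\<beta> y' - \<beta> y)" for x x' y y'
  proof -
    have "n dvd (\<alpha> x + \<beta> y' - \<gamma> (x - twist (y' - x))) - (\<alpha> x' + \<beta> y - \<gamma> (x' - twist (y - x')))
        + ((\<alpha> x' - \<alpha> x) - (\<beta> y' - \<beta> y))"
      by (rule dvd_add[OF dvd_diff[OF add add] that])
    then have "n dvd \<gamma> (x' - twist (y - x')) - \<gamma> (x - twist (y' - x))" by (simp add: algebra_simps)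
    then have "n dvd (x' - twist (y - x')) - (x - twist (y' - x))" by (rule inj(3))
    moreover have "(x' + 1 - twist (y + 1 - (x' + 1))) - (x + 1 - twist (y' + 1 - (x + 1)))
        = (x' - twist (y - x')) - (x - twist (y' - x))" by simp
    ultimately have "n dvd (x' + 1 - twist (y + 1 - (x' + 1))) - (x + 1 - twist (y' + 1 - (x + 1)))" by (simp only:)
    note per(3)[OF this]
    from dvd_add[OF dvd_diff[OF add[of "x' + 1" "y + 1"] add[of "x + 1" "y' + 1"]] this] have "n dvd (\<alpha> (x' + 1) + \<beta> (y + 1) - \<gamma> (x' + 1 - twist (y + 1 - (x' + 1))))
       - (\<alpha> (x + 1) + \<beta> (y' + 1) - \<gamma> (x + 1 - twist (y' + 1 - (x + 1))))
       + (\<gamma> (x' + 1 - twist (y + 1 - (x' + 1))) - \<gamma> (x + 1 - twist (y' + 1 - (x + 1))))"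
      .
    then show ?thesis by (simp add: algebra_simps)
  qed
  obtain x0 x1 where x: "n dvd \<alpha> x0 - 0" "n dvd \<alpha> x1 - 1" using sur(1) by blast
  obtain y0 y1 where y: "n dvd \<beta> y0 - 0" "n dvd \<beta> y1 - 1" using sur(2) by blast
  \<comment> \<open>Any pair with \<beta>-values differing by 1 is compared with this fixed
    \<alpha>-pair, then any such \<alpha>-pair with a \<beta>-pair; so one \<open>k\<close> serves
    both maps.\<close>
  define k where "k = \<alpha> (x1 + 1) - \<alpha> (x0 + 1)"
  have bk: "n dvd \<beta> (y' + 1) - \<beta> (y + 1) - k" if h: "n dvd \<beta> y' - \<beta> y - 1" for y y'
  proof -
    have "n dvd (\<alpha> x1 - 1) - (\<alpha> x0 - 0) - (\<beta> y' - \<beta> y - 1)" by (rule dvd_diff[OF dvd_diff[OF x(2,1)] h])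
    then have "n dvd (\<alpha> x1 - \<alpha> x0) - (\<beta> y' - \<beta> y)" by (simp add: algebra_simps)
    from shift[OF this] show ?thesis unfolding k_def by (subst dvd_minus_iff[symmetric]) (simp add: algebra_simps)
  qed
  have ak: "n dvd \<alpha> (x' + 1) - \<alpha> (x + 1) - k" if h: "n dvd \<alpha> x' - \<alpha> x - 1" for x x'
  proof -
    have b: "n dvd (\<beta> y1 - 1) - (\<beta> y0 - 0)" by (rule dvd_diff[OF y(2,1)])
    then have b': "n dvd \<beta> y1 - \<beta> y0 - 1" by (simp add: algebra_simps)
    have "n dvd (\<alpha> x' - \<alpha> x - 1) - (\<beta> y1 - \<beta> y0 - 1)" by (rule dvd_diff[OF h b'])
    then have "n dvd (\<alpha> x' - \<alpha> x) - (\<beta> y1 - \<beta> y0)" by (simp add: algebra_simps)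
    from dvd_add[OF shift[OF this] bk[OF b']] show ?thesis by (simp add: algebra_simps)
  qed
  obtain s where s: "\<And>i. n dvd \<alpha> (int i) - \<alpha> 0 - s * int i"
    using shift_const[OF n_prime per(1) inj(1) sur(1) ak] by blast
  obtain t where t: "\<And>i. n dvd \<beta> (int i) - \<beta> 0 - t * int i"
    using shift_const[OF n_prime per(2) inj(2) sur(2) bk] by blast
  have g: "n dvd \<gamma> (int i) - (\<alpha> 0 + \<beta> 0) - (s + t) * int i" for i
  proof -
    have "n dvd (\<alpha> (int i) - \<alpha> 0 - s * int i) + (\<beta> (int i) - \<beta> 0 - t * int i)
      - (\<alpha> (int i) + \<beta> (int i) - \<gamma> (int i - twist (int i - int i)))"
      by (rule dvd_diff[OF dvd_add[OF s t] add])
    then show ?thesis by (simp add: twist_def algebra_simps)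
  qed
  \<comment> \<open>Evaluation at \<open>(0, c)\<close> with \<open>c\<close> in \<open>B\<close>
    gives \<open>2 * s + t = 0\<close>, evaluation at \<open>(0, 1)\<close> gives
    \<open>s + 2 * t = 0\<close>. Hence \<open>3 * t = 0\<close>, and \<beta> would be
    constant.\<close>
  obtain b where b: "b \<in> B" "\<not> n dvd b" using B_nz by blast
  define c where "c = nat (b mod n)"
  have c: "int c \<in> B" "\<not> n dvd int c" using b n_pos B_mod[of b] by (auto simp: c_def dvd_eq_mod_eq_0)
  have "n dvd (\<alpha> 0 + \<beta> (int c) - \<gamma> (0 - twist (int c - 0))) + (\<gamma> (int (2 * c)) - (\<alpha> 0 + \<beta> 0) - (s + t) * int (2 * c))
      - (\<beta> (int c) - \<beta> 0 - t * int c)"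
    by (rule dvd_diff[OF dvd_add[OF add g] t])
  then have "n dvd - (int c * (2 * s + t))" using c by (simp add: twist_def algebra_simps)
  then have "n dvd int c * (2 * s + t)" by (simp only: dvd_minus_iff)
  then have 1: "n dvd 2 * s + t" using c n_prime prime_dvd_mult_iff by blast
  \<comment> \<open>The affine formula for \<gamma> is available at natural numbers only, so -1 is
    replaced by \<open>n - 1\<close>.\<close>
  have m: "n dvd \<gamma> (- 1) - \<gamma> (int (nat (n - 1)))" using n_gt_3 by (intro per(3)) simp
  have "n dvd (\<alpha> 0 + \<beta> (int 1) - \<gamma> (0 - twist (int 1 - 0))) + (\<gamma> (- 1) - \<gamma> (int (nat (n - 1))))
     + (\<gamma> (int (nat (n - 1))) - (\<alpha> 0 + \<beta> 0) - (s + t) * int (nat (n - 1)))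
      - (\<beta> (int 1) - \<beta> 0 - t * int 1) + n * (s + t)"
    by (rule dvd_add[OF dvd_diff[OF dvd_add[OF dvd_add[OF add m] g] t] dvd_triv_left])
  then have 2: "n dvd s + 2 * t" using B_1 n_gt_3 by (simp add: twist_def algebra_simps)
  have "n dvd 2 * (s + 2 * t) - (2 * s + t)" by (rule dvd_diff[OF dvd_mult[OF 2] 1])
  then have "n dvd 3 * t" by (simp add: algebra_simps)
  moreover have "\<not> n dvd 3" using n_gt_3 by (auto dest: zdvd_imp_le)
  ultimately have "n dvd t" using n_prime prime_dvd_mult_iff by blast
  then have "n dvd (\<beta> (int 1) - \<beta> 0 - t * int 1) + t" by (rule dvd_add[OF t])
  then have "n dvd \<beta> 1 - \<beta> 0" by simp
  then have "n dvd 1" using inj(2)[of 1 0] by simp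
  then show False using n_gt_3 by (auto dest: zdvd_imp_le)
qed

end

section \<open>The quasigroup\<close>

context falconer_band
begin

definition untwist :: "int \<Rightarrow> int" where "untwist d = (if d \<in> B then half * d else d)"

text \<open>For the right division put d = y - x. The product z of x and y satisfies z - y = - d -
  \<open>twist d\<close>, which is d for d in \<open>B\<close> and -2 d otherwise; as
  \<open>B\<close> is invariant under -2, testing z - y for membership decides which case to
  invert.\<close>

definition base :: "int quasigroup" where
  "base = \<lparr>carrier = {0..<n},
     mult = \<lambda>x y. (x - twist (y - x)) mod n,
     ldiv = \<lambda>x z. (x + untwist (x - z)) mod n,
     rdiv = \<lambda>z y. (y - (if z - y \<in> B then z - y else half * (z - y))) mod n\<rparr>"

lemma carrier_base [simp]: "carrier base = {0..<n}"
  by (simp add: base_def)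

lemma twist_cong: "x mod n = y mod n \<Longrightarrow> twist x mod n = twist y mod n"
  using B_cong[of x y] by (auto simp: twist_def intro: mod_mult_cong mod_minus_cong)

lemma untwist_cong: "x mod n = y mod n \<Longrightarrow> untwist x mod n = untwist y mod n"
  using B_cong[of x y] by (auto simp: untwist_def intro: mod_mult_cong)

lemma twist_B: "twist x \<in> B \<longleftrightarrow> x \<in> B" and untwist_B: "untwist x \<in> B \<longleftrightarrow> x \<in> B"
  using B_dbl[of x] half_B[of x] by (auto simp: twist_def untwist_def)

lemma twist_untwist: "twist (untwist x) mod n = x mod n" and untwist_twist: "untwist (twist x) mod n = x mod n"
proof -
  show "twist (untwist x) mod n = x mod n"
    using dbl_half[of x] untwist_B[of x] by (auto simp: twist_def untwist_def)
  show "untwist (twist x) mod n = x mod n"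
    using half_dbl[of x] twist_B[of x] by (auto simp: twist_def untwist_def)
qed

lemma base_quasigroup: "is_quasigroup base"
  unfolding is_quasigroup_def
proof (intro conjI ballI)
  show "carrier base \<noteq> {}" using n_pos by simp
  fix x y assume xy: "x \<in> carrier base" "y \<in> carrier base"
  then have m: "x mod n = x" "y mod n = y" by simp_all
  show "mult base x y \<in> carrier base" "ldiv base x y \<in> carrier base" "rdiv base x y \<in> carrier base"
    using n_pos by (simp_all add: base_def)
  have "twist ((x + untwist (x - y)) mod n - x) mod n = twist (untwist (x - y)) mod n"
    by (rule twist_cong) (simp add: mod_diff_left_eq)
  then have "twist ((x + untwist (x - y)) mod n - x) mod n = (x - y) mod n" unfolding twist_untwist .
  from mod_diff_cong[OF refl this, of x] show "mult base x (ldiv base x y) = y"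
    using m by (simp add: base_def)
  have "untwist (x - (x - twist (y - x)) mod n) mod n = untwist (twist (y - x)) mod n"
    by (rule untwist_cong) (simp add: mod_diff_right_eq)
  then have "untwist (x - (x - twist (y - x)) mod n) mod n = (y - x) mod n" unfolding untwist_twist .
  from mod_add_cong[OF refl this, of x] show "ldiv base x (mult base x y) = y"
    using m by (simp add: base_def)
  define d where "d = (if y - x \<in> B then y - x else half * (y - x))"
  have "twist (x - (x - d) mod n) mod n = twist d mod n"
    by (rule twist_cong) (simp add: mod_diff_right_eq)
  from mod_diff_cong[OF refl this, of "x - d"]
  have "((x - d) - twist (x - (x - d) mod n)) mod n = (x - d - twist d) mod n" .
  also have "\<dots> = y mod n"
  proof (cases "y - x \<in> B")
    case True then show ?thesis by (simp add: d_def twist_def)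
  next
    case False
    then have *: "x - d - twist d = x - 2 * (half * (y - x))" by (simp add: d_def twist_def half_B)
    show ?thesis unfolding * using mod_diff_cong[OF refl half_neg_dbl[of "y - x"], of x] by simp
  qed
  finally show "mult base (rdiv base y x) x = y"
    using m mod_diff_left_eq[of "x - d" n "twist (x - (x - d) mod n)"] by (simp add: base_def d_def)
  define e where "e = (y - twist (x - y)) mod n - x"
  have e: "e mod n = (y - x - twist (x - y)) mod n" by (simp add: e_def mod_diff_left_eq algebra_simps)
  have "(if e \<in> B then e else half * e) mod n = (x - y) mod n"
  proof (cases "x - y \<in> B")
    case True
    then have e': "e mod n = (x - y) mod n" using e by (simp add: twist_def)
    then show ?thesis using True B_cong[OF e'] by simp
  next
    case False
    then have e': "e mod n = (-2 * (x - y)) mod n" using e by (simp add: twist_def)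
    then have "e \<notin> B" using False B_cong[OF e'] B_dbl[of "x - y"] by simp
    moreover have "half * e mod n = (half * (-2 * (x - y))) mod n" by (rule mod_mult_cong[OF refl e'])
    ultimately show ?thesis unfolding half_dbl by simp
  qed
  from mod_diff_cong[OF refl this, of x]
  have "(x - (if e \<in> B then e else half * e)) mod n = y" using m by simp
  moreover have "rdiv base (mult base y x) x = (x - (if e \<in> B then e else half * e)) mod n"
    unfolding e_def by (simp add: base_def)
  ultimately show "rdiv base (mult base y x) x = y" by metis
qed

text \<open>The permutation carrying row \<open>a\<close> of the Latin square to row
  \<open>x\<close>. These are the left translations of the principal isotopes.\<close>

definition row_map :: "int \<Rightarrow> int \<Rightarrow> int \<Rightarrow> int" where
  "row_map x a z = mult base x (ldiv base a z)"

lemma row_map_eq: "row_map x a z = (x - twist (a - x + untwist (a - z))) mod n"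
proof -
  have "twist ((a + untwist (a - z)) mod n - x) mod n = twist (a - x + untwist (a - z)) mod n"
    by (rule twist_cong) (simp add: mod_diff_left_eq algebra_simps)
  from mod_diff_cong[OF refl this, of x] show ?thesis
    by (simp add: row_map_def base_def)
qed

lemma band_walk_scaled: "band_walk n {d. c * d \<in> B}"
proof
  fix x
  show "x mod n \<in> {d. c * d \<in> B} \<longleftrightarrow> x \<in> {d. c * d \<in> B}"
    using B_cong[of "c * (x mod n)" "c * x"] by (simp add: mod_mult_right_eq)
  show "-2 * x \<in> {d. c * d \<in> B} \<longleftrightarrow> x \<in> {d. c * d \<in> B}"
    using B_dbl[of "c * x"] by (simp add: mult.left_commute)
qed (use odd_n n_pos B_0 in auto)

text \<open>Up to conjugation by \<open>\<kappa>\<close>, the row permutation is \<open>row\<close> for the set \<open>B\<close> divided by \<open>a - x\<close>.\<close>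

lemma row_map_cycle:
  assumes xa: "x \<in> {0..<n}" "a \<in> {0..<n}" "x \<noteq> a" and z: "z \<in> {0..<n}"
  shows "(row_map x a ^^ nat n) z = z" and "w \<in> {0..<n} \<Longrightarrow> \<exists>k. (row_map x a ^^ k) z = w"
proof -
  define c where "c = a - x"
  have c: "\<not> n dvd c"
  proof
    assume "n dvd c"
    then have "a mod n = x mod n" by (simp add: c_def mod_eq_dvd_iff)
    then show False using xa by simp
  qed
  interpret s: band_walk n "{d. c * d \<in> B}" by (rule band_walk_scaled)
  have sc: "(c * s.twist_mod u) mod n = twist (c * u) mod n" for u
    by (auto simp: s.twist_mod_def twist_def mod_mult_right_eq mult.left_commute)
  have sc': "(c * s.untwist_mod u) mod n = untwist (c * u) mod n" for u
    by (auto simp: s.untwist_mod_def untwist_def mod_mult_right_eq mult.left_commute)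
  \<comment> \<open>Modulo \<open>n\<close>, \<open>\<kappa> u\<close> is the entry of row
    \<open>a\<close> in column \<open>x + c * u\<close>; the entry of row \<open>x\<close> in that
    column is \<open>x - twist (c * u)\<close>.\<close>
  define \<kappa> where "\<kappa> u = (a - twist (c * u - c)) mod n" for u
  have \<kappa>_inv: "untwist (a - \<kappa> u) mod n = (c * u - c) mod n" for u
  proof -
    have "untwist (a - \<kappa> u) mod n = untwist (twist (c * u - c)) mod n"
      by (rule untwist_cong) (simp add: \<kappa>_def mod_diff_right_eq)
    then show ?thesis unfolding untwist_twist .
  qed
  have conj: "row_map x a (\<kappa> u) = \<kappa> (s.row u)" for u
  proof -
    have "twist (c + untwist (a - \<kappa> u)) mod n = twist (c * u) mod n"
      by (rule twist_cong) (use mod_add_cong[OF refl \<kappa>_inv, of c u] in simp)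
    from mod_diff_cong[OF refl this, of x]
    have 1: "row_map x a (\<kappa> u) = (x - twist (c * u)) mod n"
      by (simp add: row_map_eq c_def)
    define v where "v = (s.twist_mod u + 1) mod n"
    have "(c * s.row u - c) mod n = (c * (s.untwist_mod v + 1) - c) mod n"
      by (rule mod_diff_cong) (simp_all add: s.row_def v_def mod_mult_right_eq)
    also have "\<dots> = untwist (c * v) mod n" using sc'[of v] by (simp add: distrib_left)
    finally have "twist (c * s.row u - c) mod n = twist (untwist (c * v)) mod n" by (rule twist_cong)
    also have "\<dots> = c * (s.twist_mod u + 1) mod n" unfolding twist_untwist v_def by (simp add: mod_mult_right_eq)
    also have "\<dots> = (twist (c * u) + c) mod n"
      using mod_add_cong[OF sc[of u] refl, of c] by (simp add: distrib_left)
    finally have "\<kappa> (s.row u) = (a - (twist (c * u) + c)) mod n"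
      unfolding \<kappa>_def by (rule mod_diff_cong[OF refl])
    also have "a - (twist (c * u) + c) = x - twist (c * u)" by (simp add: c_def)
    finally show ?thesis using 1 by simp
  qed
  have "inj_on \<kappa> {0..<n}"
  proof
    fix u v assume uv: "u \<in> {0..<n}" "v \<in> {0..<n}" "\<kappa> u = \<kappa> v"
    then have "(c * u - c) mod n = (c * v - c) mod n" using \<kappa>_inv by metis
    then have "n dvd c * (u - v)" by (simp add: mod_eq_dvd_iff right_diff_distrib)
    then have "n dvd u - v" using c n_prime prime_dvd_mult_iff by blast
    then have "u mod n = v mod n" by (simp add: mod_eq_dvd_iff)
    then show "u = v" using uv by simp
  qed
  moreover have "\<kappa> ` {0..<n} \<subseteq> {0..<n}" using n_pos by (auto simp: \<kappa>_def)
  ultimately have "\<kappa> ` {0..<n} = {0..<n}" by (simp add: endo_inj_surj)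
  then have sur: "\<exists>u\<in>{0..<n}. w = \<kappa> u" if "w \<in> {0..<n}" for w using that by blast
  have pw: "(row_map x a ^^ k) (\<kappa> u) = \<kappa> ((s.row ^^ k) u)" for k u
    by (induction k) (simp_all add: conj)
  show "(row_map x a ^^ nat n) z = z" using sur[OF z] pw s.row_cycle(1) by metis
  show "w \<in> {0..<n} \<Longrightarrow> \<exists>k. (row_map x a ^^ k) z = w" using sur[OF z] sur[of w] pw s.row_cycle(2) by metis
qed

end

section \<open>The variety\<close>

text \<open>In a group, a term with all variables set to g evaluates to g raised to this
  number.\<close>

fun exponent :: "qterm \<Rightarrow> int" where
  "exponent (Var i) = 1"
| "exponent (Mult s t) = exponent s + exponent t"
| "exponent (LDiv s t) = exponent t - exponent s"
| "exponent (RDiv s t) = exponent s - exponent t"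

fun collapse :: "qterm \<Rightarrow> qterm" where
  "collapse (Var i) = Var 0"
| "collapse (Mult s t) = Mult (collapse s) (collapse t)"
| "collapse (LDiv s t) = LDiv (collapse s) (collapse t)"
| "collapse (RDiv s t) = RDiv (collapse s) (collapse t)"

lemma term_value_collapse: "term_value Q \<rho> (collapse t) = term_value Q (\<lambda>_. \<rho> 0) t"
  by (induction t) simp_all

definition power_identity :: "nat \<Rightarrow> identity" where
  "power_identity k = ((Mult (Var 0) ^^ k) (Var 1), Var 1)"

lemma satisfies_power_identity:
  "satisfies Q (power_identity k) \<longleftrightarrow> (\<forall>x\<in>carrier Q. \<forall>z\<in>carrier Q. (mult Q x ^^ k) z = z)"
proof -
  have v: "term_value Q \<rho> ((Mult (Var 0) ^^ k) (Var 1)) = (mult Q (\<rho> 0) ^^ k) (\<rho> 1)" for \<rho>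
    by (induction k) simp_all
  show ?thesis
  proof
    assume s: "satisfies Q (power_identity k)"
    show "\<forall>x\<in>carrier Q. \<forall>z\<in>carrier Q. (mult Q x ^^ k) z = z"
    proof (intro ballI)
      fix x z assume xz: "x \<in> carrier Q" "z \<in> carrier Q"
      define \<rho> where "\<rho> i = (if i = 0 then x else z)" for i :: nat
      have "range \<rho> \<subseteq> carrier Q" using xz by (auto simp: \<rho>_def)
      from s[unfolded satisfies_def, rule_format, OF this]
      show "(mult Q x ^^ k) z = z" unfolding power_identity_def fst_conv snd_conv v by (simp add: \<rho>_def)
    qed
  next
    assume "\<forall>x\<in>carrier Q. \<forall>z\<in>carrier Q. (mult Q x ^^ k) z = z"
    then show "satisfies Q (power_identity k)"
      unfolding satisfies_def power_identity_def fst_conv snd_conv v by (simp add: image_subset_iff)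
  qed
qed

lemma funpow_prime_fix:
  assumes p: "prime p" and fp: "(f ^^ p) s = s" and fd: "(f ^^ d) s = s" and d: "0 < d" "d < p"
  shows "f s = s"
proof -
  have "coprime d p" using p d by (metis coprime_commute dvd_imp_le not_less prime_imp_coprime)
  then obtain x y where "d * x = p * y + gcd d p" using bezout_nat[of d p] d by auto
  with \<open>coprime d p\<close> have xy: "d * x = p * y + 1" by simp
  have "(f ^^ (d * x)) s = s" by (rule funpow_mult_fix[OF fd])
  then have "f ((f ^^ (p * y)) s) = s" unfolding xy by simp
  then show ?thesis using funpow_mult_fix[OF fp] by simp
qed

text \<open>By cancellation, left multiplication by an element other than the neutral one has no
  fixed point. Its \<open>p\<close>-th power is the identity and \<open>p\<close> is prime, so its
  orbits have \<open>p\<close> elements.\<close>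

lemma prime_le_card_loop:
  assumes L: "is_loop Q" and nt: "nontrivial Q" and fin: "finite (carrier Q)"
    and p: "prime p" and pw: "satisfies Q (power_identity p)"
  shows "p \<le> card (carrier Q)"
proof -
  have q: "is_quasigroup Q" by (rule loop_quasigroup[OF L])
  obtain e where e: "e \<in> carrier Q" "\<And>q. q \<in> carrier Q \<Longrightarrow> mult Q e q = q"
    using L by (auto simp: is_loop_def)
  obtain x where x: "x \<in> carrier Q" "x \<noteq> e"
    using nt e(1) unfolding nontrivial_def is_singleton_def by blast
  define f where "f = mult Q x"
  have mem: "(f ^^ i) e \<in> carrier Q" for i
    by (induction i) (use e x quasigroup_closed[OF q] in \<open>auto simp: f_def\<close>)
  have nofix: "f s \<noteq> s" if s: "s \<in> carrier Q" for s
  proof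
    assume "f s = s"
    then have "rdiv Q (mult Q x s) s = rdiv Q (mult Q e s) s" using e(2)[OF s] by (simp add: f_def)
    then show False using quasigroup_div(4)[OF q s] x e by simp
  qed
  have "inj_on (\<lambda>i. (f ^^ i) e) {..<p}"
  proof (rule linorder_inj_onI')
    fix i j assume ij: "i \<in> {..<p}" "j \<in> {..<p}" "i < j"
    define s where "s = (f ^^ i) e"
    show "(f ^^ i) e \<noteq> (f ^^ j) e"
    proof
      assume "(f ^^ i) e = (f ^^ j) e"
      also have "(f ^^ j) e = (f ^^ (j - i)) s"
        using ij by (simp add: s_def flip: funpow_add comp_apply[of "f ^^ (j - i)"])
      finally have "(f ^^ (j - i)) s = s" by (simp add: s_def)
      moreover have "(f ^^ p) s = s"
        using pw x(1) mem unfolding satisfies_power_identity f_def s_def by blast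
      ultimately have "f s = s" using funpow_prime_fix[OF p, of f s "j - i"] ij by auto
      then show False using nofix mem by (simp add: s_def)
    qed
  qed
  moreover have "(\<lambda>i. (f ^^ i) e) ` {..<p} \<subseteq> carrier Q" using mem by blast
  ultimately show ?thesis using card_inj_on_le[OF _ _ fin] by fastforce
qed

section \<open>The loop isotopes of the quasigroup and their common identities\<close>

context falconer_band
begin

abbreviation isotope :: "int \<Rightarrow> int \<Rightarrow> int quasigroup" where
  "isotope \<equiv> principal_isotope base"

definition identities :: "identity set" where
  "identities = {st. \<forall>a\<in>{0..<n}. \<forall>b\<in>{0..<n}. satisfies (isotope a b) st}"

context
  fixes a b assumes ab: "a \<in> {0..<n}" "b \<in> {0..<n}"
begin

lemma isotope_quasigroup: "is_quasigroup (isotope a b)"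
  using principal_isotope_quasigroup[OF base_quasigroup] ab by simp

definition neutral :: int where "neutral = mult base a b"

lemma isotope_one:
  "neutral \<in> {0..<n}" "q \<in> {0..<n} \<Longrightarrow> mult (isotope a b) neutral q = q" "q \<in> {0..<n} \<Longrightarrow> mult (isotope a b) q neutral = q"
  using principal_isotope_one[OF base_quasigroup] quasigroup_closed[OF base_quasigroup] ab by (auto simp: neutral_def)

lemma isotope_row:
  assumes u: "u \<in> {0..<n}" "u \<noteq> neutral" and z: "z \<in> {0..<n}"
  shows "(mult (isotope a b) u ^^ nat n) z = z" and "w \<in> {0..<n} \<Longrightarrow> \<exists>k. (mult (isotope a b) u ^^ k) z = w"
proof -
  define x where "x = rdiv base u b"
  have x: "x \<in> {0..<n}" using quasigroup_closed(3)[OF base_quasigroup, of u b] u ab by (simp add: x_def)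
  have "x \<noteq> a"
  proof
    assume "x = a"
    then have "u = neutral" using quasigroup_div(3)[OF base_quasigroup, of b u] u ab by (simp add: x_def neutral_def)
    then show False using u by simp
  qed
  moreover have "mult (isotope a b) u = row_map x a"
    by (simp add: principal_isotope_def row_map_def x_def fun_eq_iff)
  ultimately show "(mult (isotope a b) u ^^ nat n) z = z"
    "w \<in> {0..<n} \<Longrightarrow> \<exists>k. (mult (isotope a b) u ^^ k) z = w"
    using row_map_cycle[OF x ab(1) _ z] by simp_all
qed

lemma isotope_power: "satisfies (isotope a b) (power_identity (nat n))"
  unfolding satisfies_power_identity
proof (intro ballI)
  fix x z assume xz: "x \<in> carrier (isotope a b)" "z \<in> carrier (isotope a b)"
  show "(mult (isotope a b) x ^^ nat n) z = z"
  proof (cases "x = neutral")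
    case True
    have "(mult (isotope a b) neutral ^^ k) z = z" for k
      by (induction k) (use isotope_one(2) xz in auto)
    then show ?thesis using True by simp
  next
    case False
    then show ?thesis using isotope_row(1) xz by simp
  qed
qed

text \<open>Left multiplication by \<open>s\<close> is a single cycle, so applying it repeatedly to
  \<open>s\<close> reaches every element.\<close>

lemma subloop_full:
  assumes S: "S \<subseteq> {0..<n}" "\<And>u v. u \<in> S \<Longrightarrow> v \<in> S \<Longrightarrow> mult (isotope a b) u v \<in> S" and s: "s \<in> S" "s \<noteq> neutral"
  shows "S = {0..<n}"
proof
  show "{0..<n} \<subseteq> S"
  proof
    fix w assume "w \<in> {0..<n}"
    then obtain k where k: "(mult (isotope a b) s ^^ k) s = w"
      using isotope_row(2)[of s s w] s S by blast
    have "(mult (isotope a b) s ^^ k) s \<in> S" for k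
      by (induction k) (use S s in auto)
    then show "w \<in> S" using k by blast
  qed
qed (rule S)

text \<open>Composing \<theta> with the isotopy from \<open>base\<close> to the isotope gives an
  isotopy from \<open>base\<close> to the cyclic group, which \<open>no_additive_isotopy\<close>
  excludes.\<close>

lemma isotope_no_hom:
  assumes hom: "\<And>u v. u \<in> {0..<n} \<Longrightarrow> v \<in> {0..<n} \<Longrightarrow> n dvd \<theta> u + \<theta> v - \<theta> (mult (isotope a b) u v)"
    and inj: "\<And>u v. u \<in> {0..<n} \<Longrightarrow> v \<in> {0..<n} \<Longrightarrow> n dvd \<theta> u - \<theta> v \<Longrightarrow> u = v"
  shows False
proof -
  define \<alpha> where "\<alpha> x = \<theta> (mult base (x mod n) b)" for x
  define \<beta> where "\<beta> y = \<theta> (mult base a (y mod n))" for y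
  define \<gamma> where "\<gamma> z = \<theta> (z mod n)" for z
  have m: "x mod n \<in> {0..<n}" for x using n_pos by simp
  have cl: "mult base (x mod n) b \<in> {0..<n}" "mult base a (x mod n) \<in> {0..<n}" for x
    using quasigroup_closed(1)[OF base_quasigroup] m ab by simp_all
  have inj_b: "u mod n = v mod n" if "mult base (u mod n) b = mult base (v mod n) b" for u v
    using that quasigroup_div(4)[OF base_quasigroup, of b] m ab by (metis carrier_base)
  have inj_a: "u mod n = v mod n" if "mult base a (u mod n) = mult base a (v mod n)" for u v
    using that quasigroup_div(2)[OF base_quasigroup, of a] m ab by (metis carrier_base)
  have surj: "\<exists>x. n dvd f x - u" if per: "\<And>x y. n dvd x - y \<Longrightarrow> n dvd f x - f y"
    and inj: "\<And>x y. n dvd f x - f y \<Longrightarrow> n dvd x - y" for f :: "int \<Rightarrow> int" and u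
  proof -
    have "inj_on (\<lambda>x. f x mod n) {0..<n}"
    proof
      fix x y assume xy: "x \<in> {0..<n}" "y \<in> {0..<n}" "f x mod n = f y mod n"
      then have "n dvd x - y" using inj[of x y] by (simp add: mod_eq_dvd_iff)
      then have "x mod n = y mod n" by (simp only: mod_eq_dvd_iff)
      then show "x = y" using xy by simp
    qed
    moreover have "(\<lambda>x. f x mod n) ` {0..<n} \<subseteq> {0..<n}" using m by auto
    ultimately have "(\<lambda>x. f x mod n) ` {0..<n} = {0..<n}" by (simp add: endo_inj_surj)
    then have "u mod n \<in> (\<lambda>x. f x mod n) ` {0..<n}" using m[of u] by simp
    then obtain x where "u mod n = f x mod n" by blast
    then show ?thesis by (metis mod_eq_dvd_iff)
  qed
  have per: "n dvd x - y \<Longrightarrow> n dvd \<alpha> x - \<alpha> y" "n dvd x - y \<Longrightarrow> n dvd \<beta> x - \<beta> y"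
    "n dvd x - y \<Longrightarrow> n dvd \<gamma> x - \<gamma> y" for x y
    by (simp_all add: \<alpha>_def \<beta>_def \<gamma>_def flip: mod_eq_dvd_iff)
  have inj': "n dvd \<alpha> x - \<alpha> y \<Longrightarrow> n dvd x - y" "n dvd \<beta> x - \<beta> y \<Longrightarrow> n dvd x - y"
    "n dvd \<gamma> x - \<gamma> y \<Longrightarrow> n dvd x - y" for x y
  proof -
    show "n dvd \<alpha> x - \<alpha> y \<Longrightarrow> n dvd x - y"
      using inj[OF cl(1) cl(1), of x y] inj_b[of x y] by (simp only: \<alpha>_def mod_eq_dvd_iff)
    show "n dvd \<beta> x - \<beta> y \<Longrightarrow> n dvd x - y"
      using inj[OF cl(2) cl(2), of x y] inj_a[of x y] by (simp only: \<beta>_def mod_eq_dvd_iff)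
    show "n dvd \<gamma> x - \<gamma> y \<Longrightarrow> n dvd x - y"
      using inj[OF m m, of x y] by (simp only: \<gamma>_def mod_eq_dvd_iff)
  qed
  have "n dvd \<alpha> x + \<beta> y - \<gamma> (x - twist (y - x))" for x y
  proof -
    have "mult (isotope a b) (mult base (x mod n) b) (mult base a (y mod n)) = mult base (x mod n) (y mod n)"
      using quasigroup_div(2,4)[OF base_quasigroup] m ab by (simp add: principal_isotope_def)
    also have "\<dots> = (x - twist (y - x)) mod n"
    proof -
      have "twist (y mod n - x mod n) mod n = twist (y - x) mod n" by (rule twist_cong) (simp add: mod_diff_eq)
      from mod_diff_cong[OF _ this, of "x mod n" x] show ?thesis by (simp add: base_def)
    qed
    finally show ?thesis using hom[OF cl(1)[of x] cl(2)[of y]] by (simp add: \<alpha>_def \<beta>_def \<gamma>_def)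
  qed
  from no_additive_isotopy[of \<alpha> \<beta> \<gamma>, OF per inj' surj[of \<alpha>, OF per(1) inj'(1)]
      surj[of \<beta>, OF per(2) inj'(2)] this] show False .
qed

end

text \<open>An index is a principal isotope together with a common value for all variables. There
  are finitely many of them, which allows the induction in \<open>separating_term\<close>.\<close>

definition val :: "int \<times> int \<times> int \<Rightarrow> qterm \<Rightarrow> int" where
  "val i t = (case i of (a, b, x) \<Rightarrow> term_value (isotope a b) (\<lambda>_. x) t)"

definition neutral_at :: "int \<times> int \<times> int \<Rightarrow> int" where
  "neutral_at i = (case i of (a, b, x) \<Rightarrow> mult base a b)"

text \<open>Inductive step: if every term vanishing on \<open>I\<close> and at \<open>j\<close> had exponent divisible by \<open>n\<close>,
  then the exponent would induce an isomorphism from the isotope at \<open>j\<close> onto the cyclic group.\<close>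

lemma separating_term:
  assumes "finite I" "I \<subseteq> {0..<n} \<times> {0..<n} \<times> {0..<n}"
  shows "\<exists>t. (\<forall>i\<in>I. val i t = neutral_at i) \<and> \<not> n dvd exponent t"
  using assms
proof (induction I rule: finite_induct)
  case empty
  show ?case using n_gt_3 by (intro exI[of _ "Var 0"]) (auto dest: zdvd_imp_le)
next
  case (insert j I)
  obtain a b x where j: "j = (a, b, x)" by (cases j)
  then have ab: "a \<in> {0..<n}" "b \<in> {0..<n}" and x: "x \<in> {0..<n}" using insert.prems by auto
  define P where "P = isotope a b"
  define H where "H = {t. \<forall>i\<in>I. val i t = neutral_at i}"
  define v where "v = val j"
  have q: "is_quasigroup P" unfolding P_def by (rule isotope_quasigroup[OF ab])
  have v: "v t = term_value P (\<lambda>_. x) t" for t by (simp add: v_def val_def j P_def)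
  have vmem: "v t \<in> {0..<n}" for t
    unfolding v using term_value_closed[OF q, of "\<lambda>_. x"] x by (simp add: P_def)
  have vs: "v (Mult s t) = mult P (v s) (v t)" "v (RDiv s t) = rdiv P (v s) (v t)" for s t by (simp_all add: v)
  have unit_div: "rdiv P u w = neutral_at j \<longleftrightarrow> u = w" if "u \<in> {0..<n}" "w \<in> {0..<n}" for u w
  proof -
    have u1: "neutral_at j = neutral a b" by (simp add: neutral_at_def j neutral_def[OF ab])
    have C: "u \<in> carrier P" "w \<in> carrier P" "neutral a b \<in> carrier P"
      using that isotope_one(1)[OF ab] by (simp_all add: P_def)
    have o: "mult P (neutral a b) w = w" using isotope_one(2)[OF ab] that by (simp add: P_def)
    show ?thesis
    proof
      assume "rdiv P u w = neutral_at j"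
      then show "u = w" using quasigroup_div(3)[OF q C(2,1)] o u1 by simp
    next
      assume "u = w"
      then show "rdiv P u w = neutral_at j" using quasigroup_div(4)[OF q C(2,3)] o u1 by simp
    qed
  qed
  have H: "Mult s t \<in> H" "RDiv s t \<in> H" if "s \<in> H" "t \<in> H" for s t
  proof -
    have "val i (Mult s t) = neutral_at i \<and> val i (RDiv s t) = neutral_at i" if i: "i \<in> I" for i
    proof -
      obtain c d y where i': "i = (c, d, y)" by (cases i)
      then have cd: "c \<in> {0..<n}" "d \<in> {0..<n}" using insert.prems i by auto
      have "val i s = neutral_at i" "val i t = neutral_at i" using \<open>s \<in> H\<close> \<open>t \<in> H\<close> i by (auto simp: H_def)
      then have "val i (Mult s t) = mult (isotope c d) (neutral_at i) (neutral_at i)"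
        "val i (RDiv s t) = rdiv (isotope c d) (neutral_at i) (neutral_at i)" by (simp_all add: val_def i')
      moreover have "mult (isotope c d) (neutral_at i) (neutral_at i) = neutral_at i" "neutral_at i \<in> {0..<n}"
        using isotope_one[OF cd] by (simp_all add: neutral_at_def i' neutral_def[OF cd])
      moreover then have "rdiv (isotope c d) (neutral_at i) (neutral_at i) = neutral_at i"
        using quasigroup_div(4)[OF isotope_quasigroup[OF cd], of "neutral_at i" "neutral_at i"] by simp
      ultimately show ?thesis by simp
    qed
    then show "Mult s t \<in> H" "RDiv s t \<in> H" by (auto simp: H_def)
  qed
  obtain t0 where t0: "t0 \<in> H" "\<not> n dvd exponent t0" using insert by (auto simp: H_def)
  show ?case
  proof (rule ccontr)
    assume "\<not> ?thesis"
    then have triv: "n dvd exponent t" if "t \<in> H" "v t = neutral_at j" for t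
      using that by (auto simp: H_def v_def)
    have neutral_at_j: "neutral_at j = neutral a b" by (simp add: neutral_at_def j neutral_def[OF ab])
    \<comment> \<open>On \<open>H\<close> the exponent modulo \<open>n\<close> depends only on the
      value at \<open>j\<close>, because terms with equal values have a quotient that vanishes
      there.\<close>
    have wd: "n dvd exponent s - exponent t" if "s \<in> H" "t \<in> H" "v s = v t" for s t
      using triv[OF H(2)[OF that(1,2)]] unit_div vmem that(3) by (simp add: vs)
    have full: "v ` K = {0..<n}"
      if "K \<subseteq> H" "\<And>s t. s \<in> K \<Longrightarrow> t \<in> K \<Longrightarrow> Mult s t \<in> K" "u \<in> K" "v u \<noteq> neutral_at j" for K u
    proof (rule subloop_full[OF ab])
      show "v ` K \<subseteq> {0..<n}" using vmem by blast
      fix y z assume "y \<in> v ` K" "z \<in> v ` K"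
      then obtain s t where st: "s \<in> K" "t \<in> K" "y = v s" "z = v t" by blast
      then have "mult (isotope a b) y z = v (Mult s t)" by (simp add: vs P_def)
      then show "mult (isotope a b) y z \<in> v ` K" using that(2)[OF st(1,2)] by blast
    next
      show "v u \<in> v ` K" "v u \<noteq> neutral a b" using that neutral_at_j by auto
    qed
    have "v t0 \<noteq> neutral_at j" using triv t0 by blast
    from full[OF subset_refl H(1) t0(1) this] have vH: "v ` H = {0..<n}" .
    have inj: "v s = v t" if st: "s \<in> H" "t \<in> H" "n dvd exponent s - exponent t" for s t
    proof (rule ccontr)
      assume "v s \<noteq> v t"
      \<comment> \<open>The quotient of \<open>s\<close> and \<open>t\<close> lies in
        \<open>K\<close> and does not vanish at \<open>j\<close>, so the terms in \<open>K\<close>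
        take every value there, also that of \<open>t0\<close>. By \<open>wd\<close> the exponent of
        \<open>t0\<close> would be divisible by \<open>n\<close>.\<close>
      define K where "K = {t \<in> H. n dvd exponent t}"
      have "v ` K = {0..<n}"
      proof (rule full)
        show "RDiv s t \<in> K" using st H(2) by (simp add: K_def)
        show "v (RDiv s t) \<noteq> neutral_at j" using unit_div vmem \<open>v s \<noteq> v t\<close> by (simp add: vs)
      qed (use H(1) in \<open>auto simp: K_def\<close>)
      then have "v t0 \<in> v ` K" using vmem[of t0] by simp
      then obtain t' where t': "t' \<in> K" "v t' = v t0" by auto
      then have "n dvd exponent t0 - exponent t'" using wd t0 by (simp add: K_def)
      moreover have "n dvd exponent t'" using t' by (simp add: K_def)
      ultimately have "n dvd exponent t0 - exponent t' + exponent t'" by (rule dvd_add)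
      then show False using t0 by simp
    qed
    define r where "r z = (SOME t. t \<in> H \<and> v t = z)" for z
    have r: "r z \<in> H" "v (r z) = z" if "z \<in> {0..<n}" for z
    proof -
      have "z \<in> v ` H" using that vH by simp
      then have "\<exists>t. t \<in> H \<and> v t = z" by blast
      then have "r z \<in> H \<and> v (r z) = z" unfolding r_def by (rule someI_ex)
      then show "r z \<in> H" "v (r z) = z" by auto
    qed
    show False
    proof (rule isotope_no_hom[OF ab, of "\<lambda>z. exponent (r z)"])
      fix y z assume yz: "y \<in> {0..<n}" "z \<in> {0..<n}"
      have "mult P y z \<in> {0..<n}" using quasigroup_closed(1)[OF q] yz by (simp add: P_def)
      then have "n dvd exponent (Mult (r y) (r z)) - exponent (r (mult P y z))"
        using yz r H(1) by (intro wd) (auto simp: vs)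
      then show "n dvd exponent (r y) + exponent (r z) - exponent (r (mult (isotope a b) y z))"
        by (simp add: P_def)
      assume "n dvd exponent (r y) - exponent (r z)"
      then show "y = z" using inj yz r by metis
    qed
  qed
qed

text \<open>The language has no constant for the neutral element;
  \<open>RDiv (Var 0) (Var 0)\<close> denotes it.\<close>

lemma separating_identity:
  "\<exists>t. (collapse t, RDiv (Var 0) (Var 0)) \<in> identities \<and> \<not> n dvd exponent t"
proof -
  obtain t where t: "\<forall>i\<in>{0..<n} \<times> {0..<n} \<times> {0..<n}. val i t = neutral_at i" "\<not> n dvd exponent t"
    using separating_term[of "{0..<n} \<times> {0..<n} \<times> {0..<n}"] by auto
  have "satisfies (isotope a b) (collapse t, RDiv (Var 0) (Var 0))" if ab: "a \<in> {0..<n}" "b \<in> {0..<n}" for a b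
    unfolding satisfies_def fst_conv snd_conv term_value_collapse
  proof (intro allI impI)
    fix \<rho> :: "nat \<Rightarrow> int" assume "range \<rho> \<subseteq> carrier (isotope a b)"
    then have r: "\<rho> 0 \<in> {0..<n}" using rangeI[of \<rho> 0] by (auto simp only: carrier_principal_isotope carrier_base)
    have "rdiv (isotope a b) (mult (isotope a b) (mult base a b) (\<rho> 0)) (\<rho> 0) = mult base a b"
      using quasigroup_div(4)[OF isotope_quasigroup[OF ab], of "\<rho> 0" "mult base a b"] isotope_one(1)[OF ab] r
      by (simp add: neutral_def[OF ab])
    then have "term_value (isotope a b) \<rho> (RDiv (Var 0) (Var 0)) = mult base a b"
      using isotope_one(2)[OF ab r] by (simp add: neutral_def[OF ab])
    moreover have "term_value (isotope a b) (\<lambda>_. \<rho> 0) t = mult base a b"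
      using t(1) ab r by (fastforce simp: val_def neutral_at_def)
    ultimately show "term_value (isotope a b) (\<lambda>_. \<rho> 0) t = term_value (isotope a b) \<rho> (RDiv (Var 0) (Var 0))"
      by simp
  qed
  then show ?thesis using t(2) unfolding identities_def by blast
qed

section \<open>The common identities define a Falconer variety\<close>

lemma anti_associative_identities:
  "anti_associative (loop_variety identities :: 'a quasigroup set)"
  unfolding anti_associative_def
proof (intro ballI impI)
  fix G :: "'a quasigroup"
  assume G: "G \<in> loop_variety identities" and assoc: "is_assoc G"
  have L: "is_loop G" using G by (simp add: loop_variety_def)
  then have q: "is_quasigroup G" by (rule loop_quasigroup)
  obtain e where e: "e \<in> carrier G" "\<And>q. q \<in> carrier G \<Longrightarrow> mult G e q = q" "\<And>q. q \<in> carrier G \<Longrightarrow> mult G q e = q"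
    using L by (auto simp: is_loop_def)
  have "power_identity (nat n) \<in> identities" unfolding identities_def using isotope_power by blast
  then have "satisfies G (power_identity (nat n))" using G by (simp add: loop_variety_def)
  then have pw: "(mult G x ^^ nat n) z = z" if "x \<in> carrier G" "z \<in> carrier G" for x z
    using that by (simp add: satisfies_power_identity)
  obtain t where t: "(collapse t, RDiv (Var 0) (Var 0)) \<in> identities" "\<not> n dvd exponent t"
    using separating_identity by blast
  then have tG: "satisfies G (collapse t, RDiv (Var 0) (Var 0))" using G by (simp add: loop_variety_def)
  have "g = e" if g: "g \<in> carrier G" for g
  proof -
    define f where "f k = (mult G g ^^ k) e" for k
    have fm: "f k \<in> carrier G" for k
      by (induction k) (use e g quasigroup_closed(1)[OF q] in \<open>auto simp: f_def\<close>)
    have fadd: "mult G (f i) (f j) = f (i + j)" for i j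
    proof (induction i)
      case 0 then show ?case using e fm by (simp add: f_def)
    next
      case (Suc i)
      have "mult G (mult G g (f i)) (f j) = mult G g (mult G (f i) (f j))"
        using assoc g fm unfolding is_assoc_def by blast
      then show ?case using Suc by (simp add: f_def)
    qed
    have fn: "f (nat n) = e" using pw[OF g e(1)] by (simp add: f_def)
    have fk: "f (nat n * k) = e" for k
    proof (induction k)
      case (Suc k) then show ?case using fadd[of "nat n" "nat n * k"] fn e by simp
    qed (simp add: f_def)
    have fmod: "f (k mod nat n) = f k" for k
      using fadd[of "nat n * (k div nat n)" "k mod nat n"] fk e(2) fm by simp
    \<comment> \<open>The power of \<open>g\<close> with integer exponent \<open>z\<close>, well
      defined because the \<open>n\<close>-th power is neutral.\<close>
    define F where "F z = f (nat (z mod n))" for z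
    have Fm: "F z \<in> carrier G" for z using fm by (simp add: F_def)
    have Fadd: "mult G (F y) (F z) = F (y + z)" for y z
    proof -
      have "nat ((y + z) mod n) = (nat (y mod n) + nat (z mod n)) mod nat n"
        using n_pos by (simp add: nat_mod_distrib[symmetric] nat_add_distrib[symmetric] mod_add_eq)
      then show ?thesis using fmod fadd by (simp add: F_def)
    qed
    have F1: "F 1 = g" using n_gt_3 e g by (simp add: F_def f_def)
    have ev: "term_value G (\<lambda>_. g) s = F (exponent s)" for s
    proof (induction s)
      case (LDiv s t)
      have "ldiv G (F (exponent s)) (mult G (F (exponent s)) (F (exponent t - exponent s))) = F (exponent t - exponent s)"
        by (rule quasigroup_div(2)[OF q Fm Fm])
      then show ?case using LDiv by (simp add: Fadd)
    next
      case (RDiv s t)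
      have "rdiv G (mult G (F (exponent s - exponent t)) (F (exponent t))) (F (exponent t)) = F (exponent s - exponent t)"
        by (rule quasigroup_div(4)[OF q Fm Fm])
      then show ?case using RDiv by (simp add: Fadd)
    qed (simp_all add: F1 Fadd)
    have "term_value G (\<lambda>_. g) (collapse t) = term_value G (\<lambda>_. g) (RDiv (Var 0) (Var 0))"
      using tG g unfolding satisfies_def by auto
    then have "F (exponent t) = F 0" using ev[of "RDiv (Var 0) (Var 0)"] ev[of t] by (simp add: term_value_collapse)
    moreover have "F 0 = e" by (simp add: F_def f_def)
    ultimately have Ft: "F (exponent t) = e" by simp
    have Fk: "F (exponent t * int k) = e" for k
    proof (induction k)
      case (Suc k) then show ?case using Fadd[of "exponent t" "exponent t * int k"] Ft e by (simp add: algebra_simps)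
    qed (simp add: F_def f_def)
    have "coprime (exponent t) n" using t(2) n_prime by (metis coprime_commute prime_imp_coprime)
    then obtain w where w: "[exponent t * w = 1] (mod n)" using cong_solve_coprime_int by blast
    have "[exponent t * int (nat (w mod n)) = exponent t * w] (mod n)"
      using n_pos by (simp add: cong_def mod_mult_right_eq)
    then have "(exponent t * int (nat (w mod n))) mod n = 1 mod n" using w by (metis cong_def)
    then have "F 1 = e" using Fk[of "nat (w mod n)"] by (simp only: F_def)
    then show "g = e" using F1 by simp
  qed
  then show "\<not> nontrivial G" using e(1) unfolding nontrivial_def is_singleton_def by blast
qed

text \<open>An isotope of an isotope of \<open>base\<close> is isotopic to \<open>base\<close>,
  hence isomorphic to one of its principal isotopes, where the identity holds.\<close>

lemma isotope_identity_mem: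
  assumes "st \<in> identities"
  shows "isotope_identity st \<in> identities"
  unfolding identities_def mem_Collect_eq satisfies_isotope_identity
proof (intro ballI)
  fix a b c d assume ab: "a \<in> {0..<n}" "b \<in> {0..<n}" and cd: "c \<in> carrier (isotope a b)" "d \<in> carrier (isotope a b)"
  let ?P = "principal_isotope (isotope a b) c d"
  note q = isotope_quasigroup[OF ab]
  have "isotopic base ?P"
    using isotopic_trans[OF isotopic_principal_isotope[OF base_quasigroup] isotopic_principal_isotope[OF q cd]] ab by simp
  then obtain a' b' h where h: "a' \<in> carrier base" "b' \<in> carrier base" "quasigroup_iso h (isotope a' b') ?P"
    using isotopic_loop_principal[OF base_quasigroup principal_isotope_loop[OF q cd]] by blast
  have "satisfies (isotope a' b') st" using assms h by (simp add: identities_def)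
  then show "satisfies ?P st"
    using iso_satisfies[OF isotope_quasigroup principal_isotope_quasigroup[OF q cd] h(3)] h by simp
qed

theorem falconer_identities_nat:
  "falconer_variety (loop_variety identities :: nat quasigroup set)"
  "smallest_nontrivial_order (loop_variety identities :: nat quasigroup set) (nat n)"
proof -
  have z: "0 \<in> {0..<n}" using n_pos by simp
  have "isotope 0 0 \<in> loop_variety identities"
    using principal_isotope_loop[OF base_quasigroup, of 0 0] z by (auto simp: loop_variety_def identities_def)
  then obtain Q :: "nat quasigroup" where Q: "Q \<in> loop_variety identities" "finite (carrier Q)" "card (carrier Q) = nat n"
    using finite_member_transfer[of "isotope 0 0" identities] by auto
  have nt: "nontrivial Q" using Q n_gt_3 by (simp add: nontrivial_card)
  have "isotopically_L_closed (loop_variety identities :: nat quasigroup set)"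
    unfolding isotopically_L_closed_iff using isotope_identity_mem by (auto simp: loop_variety_def)
  then show "falconer_variety (loop_variety identities :: nat quasigroup set)"
    unfolding falconer_variety_def nontrivial_variety_def using anti_associative_identities Q nt by blast
  have pr: "prime (nat n)" using n_prime n_pos prime_nat_int_transfer[of "nat n"] by simp
  have pw: "power_identity (nat n) \<in> identities" unfolding identities_def using isotope_power by blast
  have "nat n \<le> card (carrier P)" if "P \<in> loop_variety identities" "nontrivial P" "finite (carrier P)" for P :: "nat quasigroup"
    using prime_le_card_loop[OF _ that(2,3) pr] that(1) pw by (simp add: loop_variety_def)
  then show "smallest_nontrivial_order (loop_variety identities :: nat quasigroup set) (nat n)"
    unfolding smallest_nontrivial_order_def using Q nt by blast
qed

end

theorem theorem1p2:
  fixes p :: nat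
  assumes "prime p" and "p > 3" and "p mod 8 = 1 \<or> p mod 8 = 3"
  shows "falconer_variety (\<V> p :: 'a::infinite quasigroup set) \<and>
         smallest_nontrivial_order (\<V> p :: 'a::infinite quasigroup set) p"
proof -
  obtain B where B: "band_walk (int p) B" "1 \<notin> B" "\<exists>b\<in>B. \<not> int p dvd b"
    using ex_band[OF assms] by blast
  interpret band_walk "int p" B by (rule B)
  interpret falconer_band "int p" B
    by unfold_locales (use assms B in auto)
  have "\<exists>E. falconer_variety (loop_variety E :: nat quasigroup set) \<and>
      smallest_nontrivial_order (loop_variety E :: nat quasigroup set) p"
    using falconer_identities_nat by auto
  from someI_ex[OF this, folded falconer_identities_def]
  show ?thesis unfolding falconer_class_def using falconer_transfer by blast
qed

end
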